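(* Let $T>0$ and let $H:[0,T]\to(0,1)$ be a deterministic Hölder continuous function with exponent $\gamma>\sup_{t\in[0,T]}H(t)$ and constant $C_H>0$, and assume $\inf_{t\in[0,T]}H(t)\ge H_{\inf}>0$. Let $B^{H(\cdot)}$ be the time-varying fractional Brownian motion with Hurst function $H$ driven by a standard Brownian motion $B$. Then for any fixed $t_0\in[0,T)$ there exist constants $\epsilon_0>0$ and $c(t_0)>0$ (depending on $t_0$) such that for all $\epsilon\in(0,\epsilon_0]$, $$\mathrm{Var}\left(B^{H(\cdot)}(t_0+\epsilon)\mid\mathcal{F}_{<t_0}\right)\ge c(t_0)\cdot\epsilon^{2H(t_0)},$$ where $\mathcal{F}_{<t_0}=\sigma(\{B_s:0\le s<t_0\})$. Moreover, the optimal constant satisfies $$c(t_0)=\inf_{\epsilon\in(0,\epsilon_0]}(1+r(\epsilon)),$$ where $r(\epsilon)$ is defined by $\mathbb{E}[(I^{\mathrm{loc}}_\epsilon)^2]=\epsilon^{2H(t_0)}(1+r(\epsilon))$ with $$I^{\mathrm{loc}}_\epsilon=\sqrt{2H(t_0+\epsilon)}\int_{t_0}^{t_0+\epsilon}(t_0+\epsilon-s)^{H(t_0+\epsilon)-1/2}\,dB(s),$$ and it satisfies $|r(\epsilon)|\le c_1\epsilon^\lambda$ for some constant $c_1>0$, with $\lambda=\min\left(\gamma-H(t_0),\frac{\gamma+H(t_0)}{2}\right)$, so that $1+r(\epsilon)\to1$ as $\epsilon\to0^+$.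
   Context: A function $H:[0,T]\to(0,1)$ is Hölder continuous with exponent $\gamma>0$ and constant $C_H>0$ if $|H(t)-H(s)|\le C_H|t-s|^\gamma$ for all $t,s\in[0,T]$. Time-varying fractional Brownian motion (TV-fBm): $$B^{H(\cdot)}(t):=\sqrt{2H(t)}\int_0^t(t-s)^{H(t)-1/2}\,dB_s,\qquad t\in[0,T],$$ where the integral is the Itô integral of a deterministic integrand. The conditional variance is $\mathrm{Var}(Y\mid\mathcal{G})=\mathbb{E}[(Y-\mathbb{E}[Y\mid\mathcal{G}])^2\mid\mathcal{G}]$. "Optimal constant" means the largest constant for which the lower bound holds on $(0,\epsilon_0]$. *)

theory Defs
  imports "HOL-Probability.Probability"
begin

locale standard_brownian_motion = prob_space M for M :: "'a measure" +
  fixes B :: "real \<Rightarrow> 'a \<Rightarrow> real"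
  assumes random_variable_B: "\<And>t. 0 \<le> t \<Longrightarrow> random_variable borel (B t)"
    and start_at_zero: "AE \<omega> in M. B 0 \<omega> = 0"
    and independent_increments:
      "\<And>(n::nat) (t::nat \<Rightarrow> real). \<lbrakk>0 \<le> t 0; \<And>i. i < n \<Longrightarrow> t i \<le> t (Suc i)\<rbrakk> \<Longrightarrow>
         indep_vars (\<lambda>_. borel) (\<lambda>i \<omega>. B (t (Suc i)) \<omega> - B (t i) \<omega>) {..<n}"
    and gaussian_increments:
      "\<And>s t. \<lbrakk>0 \<le> s; s < t\<rbrakk> \<Longrightarrow>
         distributed M lborel (\<lambda>\<omega>. B t \<omega> - B s \<omega>) (normal_density 0 (sqrt (t - s)))"
    and continuous_paths: "AE \<omega> in M. continuous_on {0..} (\<lambda>t. B t \<omega>)"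

definition hoelder_continuous_on :: "real set \<Rightarrow> real \<Rightarrow> real \<Rightarrow> (real \<Rightarrow> real) \<Rightarrow> bool" where
  "hoelder_continuous_on S \<gamma> C f \<longleftrightarrow>
     \<gamma> > 0 \<and> C > 0 \<and> (\<forall>t\<in>S. \<forall>s\<in>S. \<bar>f t - f s\<bar> \<le> C * \<bar>t - s\<bar> powr \<gamma>)"

definition is_partition :: "real \<Rightarrow> real \<Rightarrow> nat \<Rightarrow> (nat \<Rightarrow> real) \<Rightarrow> bool" where
  "is_partition a b n p \<longleftrightarrow> p 0 = a \<and> p n = b \<and> (\<forall>i<n. p i \<le> p (Suc i))"

definition step_function :: "nat \<Rightarrow> (nat \<Rightarrow> real) \<Rightarrow> (nat \<Rightarrow> real) \<Rightarrow> real \<Rightarrow> real" where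
  "step_function n p c s = (\<Sum>i<n. c i * indicator {p i<..p (Suc i)} s)"

definition step_integral ::
  "(real \<Rightarrow> 'a \<Rightarrow> real) \<Rightarrow> nat \<Rightarrow> (nat \<Rightarrow> real) \<Rightarrow> (nat \<Rightarrow> real) \<Rightarrow> 'a \<Rightarrow> real" where
  "step_integral B n p c \<omega> = (\<Sum>i<n. c i * (B (p (Suc i)) \<omega> - B (p i) \<omega>))"

text \<open>The Ito integral over \<open>[a, b]\<close> of a deterministic square-integrable integrand: the limit in
  \<open>L\<^sup>2(M)\<close> of the elementary integrals of step functions that converge to the integrand in
  \<open>L\<^sup>2([a, b])\<close>. By the Ito isometry it does not depend on the approximating sequence, and it is
  determined up to almost sure equality.\<close>

definition has_ito_integral ::
  "'a measure \<Rightarrow> (real \<Rightarrow> 'a \<Rightarrow> real) \<Rightarrow> real \<Rightarrow> real \<Rightarrow> (real \<Rightarrow> real) \<Rightarrow> ('a \<Rightarrow> real) \<Rightarrow> bool" where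
  "has_ito_integral M B a b f X \<longleftrightarrow>
     set_borel_measurable lborel {a..b} f \<and>
     X \<in> borel_measurable M \<and> integrable M (\<lambda>\<omega>. (X \<omega>)\<^sup>2) \<and>
     (\<exists>(n :: nat \<Rightarrow> nat) (p :: nat \<Rightarrow> nat \<Rightarrow> real) (c :: nat \<Rightarrow> nat \<Rightarrow> real).
        (\<forall>k. is_partition a b (n k) (p k)) \<and>
        ((\<lambda>k. \<integral>\<^sup>+s\<in>{a..b}. ennreal ((f s - step_function (n k) (p k) (c k) s)\<^sup>2) \<partial>lborel)
           \<longlonglongrightarrow> 0) \<and>
        ((\<lambda>k. \<integral>\<^sup>+\<omega>. ennreal ((X \<omega> - step_integral B (n k) (p k) (c k) \<omega>)\<^sup>2) \<partial>M)
           \<longlonglongrightarrow> 0))"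

definition ito_integral ::
  "'a measure \<Rightarrow> (real \<Rightarrow> 'a \<Rightarrow> real) \<Rightarrow> real \<Rightarrow> real \<Rightarrow> (real \<Rightarrow> real) \<Rightarrow> 'a \<Rightarrow> real" where
  "ito_integral M B a b f = (SOME X. has_ito_integral M B a b f X)"

definition tv_fbm ::
  "'a measure \<Rightarrow> (real \<Rightarrow> 'a \<Rightarrow> real) \<Rightarrow> (real \<Rightarrow> real) \<Rightarrow> real \<Rightarrow> 'a \<Rightarrow> real" where
  "tv_fbm M B H t \<omega> =
     sqrt (2 * H t) * ito_integral M B 0 t (\<lambda>s. (t - s) powr (H t - 1 / 2)) \<omega>"

text \<open>The strict past: the sigma-algebra generated by \<open>B s\<close> for \<open>0 \<le> s < t\<close>, not completed by null
  sets. It is trivial for \<open>t = 0\<close>.\<close>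

definition strict_past :: "'a measure \<Rightarrow> (real \<Rightarrow> 'a \<Rightarrow> real) \<Rightarrow> real \<Rightarrow> 'a measure" where
  "strict_past M B t =
     sigma (space M) (\<Union>s\<in>{0..<t}. {B s -` A \<inter> space M | A. A \<in> sets borel})"

definition cond_variance :: "'a measure \<Rightarrow> 'a measure \<Rightarrow> ('a \<Rightarrow> real) \<Rightarrow> 'a \<Rightarrow> real" where
  "cond_variance M G Y = real_cond_exp M G (\<lambda>\<omega>. (Y \<omega> - real_cond_exp M G Y \<omega>)\<^sup>2)"

definition local_part ::
  "'a measure \<Rightarrow> (real \<Rightarrow> 'a \<Rightarrow> real) \<Rightarrow> (real \<Rightarrow> real) \<Rightarrow> real \<Rightarrow> real \<Rightarrow> 'a \<Rightarrow> real" where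
  "local_part M B H t\<^sub>0 \<epsilon> \<omega> =
     sqrt (2 * H (t\<^sub>0 + \<epsilon>)) *
     ito_integral M B t\<^sub>0 (t\<^sub>0 + \<epsilon>) (\<lambda>s. (t\<^sub>0 + \<epsilon> - s) powr (H (t\<^sub>0 + \<epsilon>) - 1 / 2)) \<omega>"

text \<open>For \<open>\<epsilon> > 0\<close> the defining equation has exactly one solution.\<close>

definition remainder ::
  "'a measure \<Rightarrow> (real \<Rightarrow> 'a \<Rightarrow> real) \<Rightarrow> (real \<Rightarrow> real) \<Rightarrow> real \<Rightarrow> real \<Rightarrow> real" where
  "remainder M B H t\<^sub>0 \<epsilon> =
     (THE r. (\<integral>\<omega>. (local_part M B H t\<^sub>0 \<epsilon> \<omega>)\<^sup>2 \<partial>M) = \<epsilon> powr (2 * H t\<^sub>0) * (1 + r))"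

text \<open>The conditional variance is determined only up to null sets, so the bound is an almost sure
  one for each \<open>\<epsilon>\<close>.\<close>

definition variance_lower_bound ::
  "'a measure \<Rightarrow> (real \<Rightarrow> 'a \<Rightarrow> real) \<Rightarrow> (real \<Rightarrow> real) \<Rightarrow> real \<Rightarrow> real \<Rightarrow> real \<Rightarrow> bool" where
  "variance_lower_bound M B H t\<^sub>0 \<epsilon>\<^sub>0 c \<longleftrightarrow>
     (\<forall>\<epsilon>\<in>{0<..\<epsilon>\<^sub>0}. AE \<omega> in M.
        cond_variance M (strict_past M B t\<^sub>0) (tv_fbm M B H (t\<^sub>0 + \<epsilon>)) \<omega> \<ge> c * \<epsilon> powr (2 * H t\<^sub>0))"

end

theory Submission
  imports Defs
begin

text \<open>Write \<open>t = t\<^sub>0 + \<epsilon>\<close> and \<open>h = H t\<close>. Splitting the stochastic integral at \<open>t\<^sub>0\<close> gives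
\<open>B\<^sup>H(t) = sqrt (2 h) (A + L)\<close>, where \<open>A\<close> integrates the kernel \<open>(t - s)\<^bsup>h - 1/2\<^esup>\<close> over \<open>[0, t\<^sub>0]\<close> and
\<open>L\<close> integrates it over \<open>[t\<^sub>0, t]\<close>. The first part is known at time \<open>t\<^sub>0\<close>; the second is independent
of the past and centred. So the conditional variance is the constant
\<open>2 h E[L\<^sup>2] = 2 h \<integral> (t - s)\<^bsup>2 h - 1\<^esup> ds = \<epsilon>\<^bsup>2 h\<^esup>\<close> by the Ito isometry, and it equals the second moment of
the local part. Hence \<open>1 + r(\<epsilon>) = \<epsilon>\<^bsup>2 (H(t\<^sub>0 + \<epsilon>) - H(t\<^sub>0))\<^esup>\<close> exactly, and the lower bound with
constant \<open>c\<close> holds on \<open>(0, \<epsilon>\<^sub>0]\<close> if and only if \<open>c \<le> 1 + r(\<epsilon>)\<close> for all these \<open>\<epsilon>\<close>: the optimal constant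
is the infimum. By Hoelder continuity the logarithm of \<open>1 + r(\<epsilon>)\<close> is at most
\<open>2 C\<^sub>H \<epsilon>\<^sup>\<gamma> \<bar>ln \<epsilon>\<bar>\<close> in absolute value, and since \<open>\<bar>ln \<epsilon>\<bar>\<close> costs at most the factor
\<open>\<epsilon>\<^bsup>- H(t\<^sub>0)\<^esup> / H(t\<^sub>0)\<close>, it is \<open>O(\<epsilon>\<^bsup>\<gamma> - H(t\<^sub>0)\<^esup>)\<close>. This gives the estimate for \<open>r\<close>, positivity of the infimum
and the limit.

The stochastic part rests on one notion. A Wiener pair consists of a square-integrable function and
the random variable that is its Wiener integral; such pairs form the closed linear span of
\<open>(1\<^bsub>(u, v]\<^esub>, B\<^sub>v - B\<^sub>u)\<close>. Induction over this span proves an isometry on every event of the past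
(\<open>wiener_pair_isometry_past\<close>) and the vanishing of the mean on such events (\<open>wiener_pair_mean_past\<close>).
Between them they give uniqueness of the integral, additivity over adjacent intervals (without
refining partitions) and the two conditional expectations in \<open>cond_variance_ito_integral\<close>. Existence
(\<open>ex_ito_integral_past_measurable\<close>) uses step functions that vanish near the right endpoint, which
makes the integral over \<open>[0, t\<^sub>0]\<close> measurable for the strict past itself, without its completion.\<close>

section \<open>Increments are independent of the past\<close>

text \<open>The strict past at \<open>t\<close> is the case \<open>S = {0..<t}\<close>. The closed interval \<open>{0..u}\<close> is the natural past
of an increment that starts at \<open>u\<close>, which is independent of \<open>B u\<close> as well; earlier increments that
end at \<open>u\<close> are measurable for it.\<close>

definition history :: "'a measure \<Rightarrow> (real \<Rightarrow> 'a \<Rightarrow> real) \<Rightarrow> real set \<Rightarrow> 'a measure" where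
  "history M B S = sigma (space M) (\<Union>s\<in>S. {B s -` A \<inter> space M | A. A \<in> sets borel})"

lemma space_history [simp]: "space (history M B S) = space M"
  unfolding history_def by (rule space_measure_of) auto

lemma sets_history:
  "sets (history M B S) =
     sigma_sets (space M) (\<Union>s\<in>S. {B s -` A \<inter> space M | A. A \<in> sets borel})"
  unfolding history_def by (rule sets_measure_of) auto

lemma strict_past_eq_history: "strict_past M B t = history M B {0..<t}"
  by (simp add: strict_past_def history_def)

lemma sets_history_mono: "S \<subseteq> S' \<Longrightarrow> sets (history M B S) \<subseteq> sets (history M B S')"
  unfolding sets_history by (intro sigma_sets_mono') auto

lemma measurable_history:
  assumes "s \<in> S"
  shows "B s \<in> borel_measurable (history M B S)"
proof (rule measurableI)
  fix A :: "real set" assume "A \<in> sets borel"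
  with assms have "B s -` A \<inter> space M \<in> (\<Union>s\<in>S. {B s -` A \<inter> space M | A. A \<in> sets borel})"
    by blast
  then show "B s -` A \<inter> space (history M B S) \<in> sets (history M B S)"
    unfolding sets_history space_history by (rule sigma_sets.Basic)
qed auto

lemma sets_Collect_mem:
  assumes "f \<in> measurable M N" "A \<in> sets N"
  shows "{x\<in>space M. f x \<in> A} \<in> sets M"
  using measurable_sets[OF assms] by (simp add: vimage_def Int_def conj_commute)

context standard_brownian_motion
begin

lemma subalgebra_history:
  assumes "S \<subseteq> {0..}"
  shows "subalgebra M (history M B S)"
proof -
  have "(\<Union>s\<in>S. {B s -` A \<inter> space M | A. A \<in> sets borel}) \<subseteq> sets M"
    using random_variable_B assms by (auto simp: measurable_def)
  then show ?thesis
    unfolding subalgebra_def sets_history by (simp add: sets.sigma_sets_subset)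
qed

text \<open>The times in \<open>J\<close>, sorted and framed by \<open>0\<close>, \<open>u\<close> and \<open>v\<close>, form a grid on which the increments are
jointly independent. The values of \<open>B\<close> on \<open>J\<close> are partial sums of the increments before \<open>u\<close>, up
to the almost surely vanishing \<open>B 0\<close>, so the cylinder event depends on those increments alone.\<close>

lemma cylinder_indep_increment:
  fixes A :: "real \<Rightarrow> real set"
  assumes "finite J" "J \<subseteq> {0..u}" "0 \<le> u" "u \<le> v"
    and A: "\<And>s. s \<in> J \<Longrightarrow> A s \<in> sets borel" and D: "D \<in> sets borel"
  shows "prob ({\<omega>\<in>space M. \<forall>s\<in>J. B s \<omega> \<in> A s} \<inter> {\<omega>\<in>space M. B v \<omega> - B u \<omega> \<in> D}) =
         prob {\<omega>\<in>space M. \<forall>s\<in>J. B s \<omega> \<in> A s} * prob {\<omega>\<in>space M. B v \<omega> - B u \<omega> \<in> D}"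
proof -
  define xs where "xs = sorted_list_of_set J"
  define n where "n = length xs"
  define t where "t i = (if i = 0 then 0 else if i \<le> n then xs ! (i - 1) else if i = n + 1 then u else v)"
    for i
  have J: "J = set xs" and srt: "sorted xs" using assms(1) by (auto simp: xs_def)
  have nth: "xs ! i \<in> J" if "i < n" for i using that J n_def by auto
  have nthb: "0 \<le> xs ! i \<and> xs ! i \<le> u" if "i < n" for i using nth[OF that] assms(2) by auto
  have tmono: "t i \<le> t (Suc i)" for i
    using nthb assms(3,4) sorted_nth_mono[OF srt, of "i - 1" i]
    by (auto simp: t_def n_def)
  define \<Delta> where "\<Delta> i \<omega> = B (t (Suc i)) \<omega> - B (t i) \<omega>" for i \<omega>
  have "indep_vars (\<lambda>_. borel) \<Delta> {..<n+2}"
    unfolding \<Delta>_def by (rule independent_increments) (use tmono in \<open>auto simp: t_def\<close>)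
  then have iv: "indep_var (PiM {..<n+1} (\<lambda>_. borel)) (\<lambda>\<omega>. restrict (\<lambda>i. \<Delta> i \<omega>) {..<n+1})
      (PiM {n+1} (\<lambda>_. borel)) (\<lambda>\<omega>. restrict (\<lambda>i. \<Delta> i \<omega>) {n+1})"
    by (rule indep_var_restrict) auto
  define P where "P = {x \<in> space (PiM {..<n+1} (\<lambda>_. borel :: real measure)). \<forall>i\<in>{..<n}. (\<Sum>j\<le>i. x j) \<in> A (xs ! i)}"
  define Q where "Q = {x \<in> space (PiM {n+1} (\<lambda>_. borel :: real measure)). x (n+1) \<in> D}"
  have P: "P \<in> sets (PiM {..<n+1} (\<lambda>_. borel))"
    unfolding P_def
    by (intro sets.sets_Collect_finite_All sets_Collect_mem[where N=borel] A[OF nth]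
        borel_measurable_sum measurable_component_singleton) auto
  have Q: "Q \<in> sets (PiM {n+1} (\<lambda>_. borel))"
    unfolding Q_def
    by (intro sets_Collect_mem[where N=borel] D measurable_component_singleton) auto
  have tele: "(\<Sum>j\<le>i. \<Delta> j \<omega>) = B (t (Suc i)) \<omega> - B 0 \<omega>" for i \<omega>
    by (induction i) (auto simp: \<Delta>_def t_def)
  have inP: "restrict (\<lambda>i. \<Delta> i \<omega>) {..<n+1} \<in> P \<longleftrightarrow> (\<forall>i<n. B (xs ! i) \<omega> - B 0 \<omega> \<in> A (xs ! i))"
    for \<omega>
  proof -
    have "(\<Sum>j\<le>i. restrict (\<lambda>i. \<Delta> i \<omega>) {..<n+1} j) = B (xs ! i) \<omega> - B 0 \<omega>" if "i < n" for i
    proof -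
      have "(\<Sum>j\<le>i. restrict (\<lambda>i. \<Delta> i \<omega>) {..<n+1} j) = (\<Sum>j\<le>i. \<Delta> j \<omega>)"
        using that by (intro sum.cong) auto
      then show ?thesis using that by (simp add: tele t_def)
    qed
    then show ?thesis by (simp add: P_def space_PiM Ball_def)
  qed
  have inQ: "restrict (\<lambda>i. \<Delta> i \<omega>) {n+1} \<in> Q \<longleftrightarrow> B v \<omega> - B u \<omega> \<in> D" for \<omega>
    by (simp add: Q_def space_PiM \<Delta>_def t_def)
  let ?F' = "{\<omega>\<in>space M. \<forall>i<n. B (xs ! i) \<omega> - B 0 \<omega> \<in> A (xs ! i)}"
  let ?F = "{\<omega>\<in>space M. \<forall>s\<in>J. B s \<omega> \<in> A s}" and ?D = "{\<omega>\<in>space M. B v \<omega> - B u \<omega> \<in> D}"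
  have [measurable]: "B 0 \<in> borel_measurable M" "B u \<in> borel_measurable M" "B v \<in> borel_measurable M"
    using random_variable_B assms by auto
  have [measurable]: "B (xs ! i) \<in> borel_measurable M" "A (xs ! i) \<in> sets borel" if "i < n" for i
    using that nthb random_variable_B A nth by auto
  have Dm [measurable]: "?D \<in> sets M" using D by measurable
  have Jn: "(\<forall>s\<in>J. B s \<omega> \<in> A s) \<longleftrightarrow> (\<forall>i\<in>{..<n}. B (xs ! i) \<omega> \<in> A (xs ! i))" for \<omega>
    unfolding J by (auto simp: all_set_conv_all_nth n_def)
  have Fm [measurable]: "?F \<in> sets M"
    unfolding Jn by (intro sets.sets_Collect_finite_All sets_Collect_mem[where N=borel]) auto
  have "?F' = {\<omega>\<in>space M. \<forall>i\<in>{..<n}. B (xs ! i) \<omega> - B 0 \<omega> \<in> A (xs ! i)}" by auto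
  also have "\<dots> \<in> sets M"
    by (intro sets.sets_Collect_finite_All sets_Collect_mem[where N=borel]) auto
  finally have F'm [measurable]: "?F' \<in> sets M" .
  have ae: "AE \<omega> in M. \<omega> \<in> ?F' \<longleftrightarrow> \<omega> \<in> ?F"
    using start_at_zero by eventually_elim (auto simp: Jn)
  have "prob (?F \<inter> ?D) = prob (?F' \<inter> ?D)"
    using ae by (intro finite_measure_eq_AE) auto
  also have "?F' \<inter> ?D = (\<lambda>\<omega>. (restrict (\<lambda>i. \<Delta> i \<omega>) {..<n+1}, restrict (\<lambda>i. \<Delta> i \<omega>) {n+1}))
      -` (P \<times> Q) \<inter> space M"
    by (auto simp: inP[simplified] inQ[simplified])
  also have "prob \<dots> = prob ((\<lambda>\<omega>. restrict (\<lambda>i. \<Delta> i \<omega>) {..<n+1}) -` P \<inter> space M) *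
      prob ((\<lambda>\<omega>. restrict (\<lambda>i. \<Delta> i \<omega>) {n+1}) -` Q \<inter> space M)"
    by (rule indep_varD[OF iv P Q])
  also have "(\<lambda>\<omega>. restrict (\<lambda>i. \<Delta> i \<omega>) {..<n+1}) -` P \<inter> space M = ?F'"
    by (auto simp: inP[simplified])
  also have "prob ?F' = prob ?F"
    using ae by (intro finite_measure_eq_AE) auto
  also have "(\<lambda>\<omega>. restrict (\<lambda>i. \<Delta> i \<omega>) {n+1}) -` Q \<inter> space M = ?D"
    by (auto simp: inQ[simplified])
  finally show ?thesis .
qed

text \<open>Cylinder events over finite sets of times are a generator of the history that is closed under
intersection, so independence extends from them to the whole sigma-algebra.\<close>

lemma history_indep_increment:
  assumes "0 \<le> u" "u \<le> v"
  shows "indep_set (sets (history M B {0..u}))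
    (sigma_sets (space M) {(\<lambda>\<omega>. B v \<omega> - B u \<omega>) -` D \<inter> space M | D. D \<in> sets borel})"
proof -
  define cyl where "cyl = {{\<omega>\<in>space M. \<forall>s\<in>J. B s \<omega> \<in> A s} | J A.
      finite J \<and> J \<subseteq> {0..u} \<and> (\<forall>s\<in>J. A s \<in> sets (borel :: real measure))}"
  define inc where "inc = {(\<lambda>\<omega>. B v \<omega> - B u \<omega>) -` D \<inter> space M | D. D \<in> sets (borel :: real measure)}"
  have stable: "Int_stable cyl"
  proof (rule Int_stableI)
    fix F F' assume "F \<in> cyl" "F' \<in> cyl"
    then obtain J A J' A' where *: "F = {\<omega>\<in>space M. \<forall>s\<in>J. B s \<omega> \<in> A s}"
        "finite J" "J \<subseteq> {0..u}" "\<forall>s\<in>J. A s \<in> sets (borel :: real measure)"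
        "F' = {\<omega>\<in>space M. \<forall>s\<in>J'. B s \<omega> \<in> A' s}"
        "finite J'" "J' \<subseteq> {0..u}" "\<forall>s\<in>J'. A' s \<in> sets (borel :: real measure)"
      unfolding cyl_def by blast
    define A'' where "A'' s = (if s \<in> J then A s else UNIV) \<inter> (if s \<in> J' then A' s else UNIV)" for s
    have "F \<inter> F' = {\<omega>\<in>space M. \<forall>s\<in>J\<union>J'. B s \<omega> \<in> A'' s}"
      unfolding * A''_def by (auto split: if_splits)
    moreover have "\<forall>s\<in>J\<union>J'. A'' s \<in> sets (borel :: real measure)" using * by (auto simp: A''_def)
    ultimately show "F \<inter> F' \<in> cyl" using * unfolding cyl_def
      by (intro CollectI exI[of _ "J \<union> J'"] exI[of _ A'']) auto
  qed
  have stable': "Int_stable inc"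
  proof (rule Int_stableI)
    fix E E' assume "E \<in> inc" "E' \<in> inc"
    then obtain D D' where *: "E = (\<lambda>\<omega>. B v \<omega> - B u \<omega>) -` D \<inter> space M" "D \<in> sets borel"
      "E' = (\<lambda>\<omega>. B v \<omega> - B u \<omega>) -` D' \<inter> space M" "D' \<in> sets borel" unfolding inc_def by blast
    show "E \<inter> E' \<in> inc" unfolding inc_def
      by (rule CollectI, rule exI[of _ "D \<inter> D'"]) (use * in auto)
  qed
  have cylM: "cyl \<subseteq> sets M"
  proof
    fix F assume "F \<in> cyl"
    then obtain J A where *: "F = {\<omega>\<in>space M. \<forall>s\<in>J. B s \<omega> \<in> A s}"
        "finite J" "J \<subseteq> {0..u}" "\<forall>s\<in>J. A s \<in> sets (borel :: real measure)"
      unfolding cyl_def by blast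
    show "F \<in> sets M" unfolding *
      by (intro sets.sets_Collect_finite_All sets_Collect_mem[where N=borel])
         (use * random_variable_B in auto)
  qed
  have [measurable]: "B u \<in> borel_measurable M" "B v \<in> borel_measurable M"
    using random_variable_B assms by auto
  have incM: "inc \<subseteq> sets M" unfolding inc_def by auto
  have "indep_set cyl inc"
  proof (rule indep_setI[OF cylM incM])
    fix F E assume "F \<in> cyl" "E \<in> inc"
    then obtain J A D where *: "F = {\<omega>\<in>space M. \<forall>s\<in>J. B s \<omega> \<in> A s}"
        "finite J" "J \<subseteq> {0..u}" "\<forall>s\<in>J. A s \<in> sets (borel :: real measure)"
        "E = (\<lambda>\<omega>. B v \<omega> - B u \<omega>) -` D \<inter> space M" "D \<in> sets borel"
      unfolding cyl_def inc_def by blast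
    have "E = {\<omega>\<in>space M. B v \<omega> - B u \<omega> \<in> D}" using * by auto
    then show "prob (F \<inter> E) = prob F * prob E"
      using cylinder_indep_increment[of J u v A D] * assms by simp
  qed
  then have ind: "indep_set (sigma_sets (space M) cyl) (sigma_sets (space M) inc)"
    by (rule indep_set_sigma_sets[OF _ stable stable'])
  have "sets (history M B {0..u}) \<subseteq> sigma_sets (space M) cyl"
    unfolding sets_history
  proof (rule sigma_sets_mono', safe)
    fix s A assume "s \<in> {0..u}" "A \<in> sets (borel :: real measure)"
    then show "B s -` A \<inter> space M \<in> cyl" unfolding cyl_def
      by (intro CollectI exI[of _ "{s}"] exI[of _ "\<lambda>_. A"]) auto
  qed
  then show ?thesis
    unfolding indep_set_def inc_def[symmetric]
    by (intro indep_sets_mono_sets[OF ind[unfolded indep_set_def]]) (auto split: bool.splits)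
qed

end

section \<open>Square-integrable functions\<close>

definition L2 :: "'a measure \<Rightarrow> ('a \<Rightarrow> real) set" where
  "L2 M = {f \<in> borel_measurable M. integrable M (\<lambda>x. (f x)\<^sup>2)}"

lemma L2_I: "f \<in> borel_measurable M \<Longrightarrow> integrable M (\<lambda>x. (f x)\<^sup>2) \<Longrightarrow> f \<in> L2 M"
  and L2_measurable [measurable_dest]: "f \<in> L2 M \<Longrightarrow> f \<in> borel_measurable M"
  and L2_square_integrable: "f \<in> L2 M \<Longrightarrow> integrable M (\<lambda>x. (f x)\<^sup>2)"
  by (simp_all add: L2_def)

lemma L2_mult_integrable:
  assumes f: "f \<in> L2 M" and g: "g \<in> L2 M"
  shows "integrable M (\<lambda>x. f x * g x)"
proof (rule Bochner_Integration.integrable_bound)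
  show "integrable M (\<lambda>x. (f x)\<^sup>2 + (g x)\<^sup>2)"
    using assms by (intro Bochner_Integration.integrable_add L2_square_integrable)
  have "\<bar>a * b\<bar> \<le> a\<^sup>2 + b\<^sup>2" for a b :: real
    using sum_squares_bound[of "\<bar>a\<bar>" "\<bar>b\<bar>"] zero_le_power2[of a] zero_le_power2[of b]
    unfolding abs_mult power2_abs by linarith
  then show "AE x in M. norm (f x * g x) \<le> norm ((f x)\<^sup>2 + (g x)\<^sup>2)" by simp
  show "(\<lambda>x. f x * g x) \<in> borel_measurable M"
    using L2_measurable[OF f] L2_measurable[OF g] by measurable
qed

lemma L2_add:
  assumes f: "f \<in> L2 M" and g: "g \<in> L2 M"
  shows "(\<lambda>x. f x + g x) \<in> L2 M"
proof (rule L2_I)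
  have "integrable M (\<lambda>x. (f x)\<^sup>2 + (g x)\<^sup>2 + 2 * (f x * g x))"
    using assms by (intro Bochner_Integration.integrable_add integrable_mult_right
        L2_square_integrable L2_mult_integrable)
  then show "integrable M (\<lambda>x. (f x + g x)\<^sup>2)" by (simp add: power2_sum mult.assoc)
qed (use L2_measurable[OF f] L2_measurable[OF g] in measurable)

lemma L2_scale:
  assumes "f \<in> L2 M"
  shows "(\<lambda>x. c * f x) \<in> L2 M"
  using assms L2_measurable[OF assms] by (auto simp: L2_def power_mult_distrib)

lemma L2_diff:
  assumes "f \<in> L2 M" "g \<in> L2 M"
  shows "(\<lambda>x. f x - g x) \<in> L2 M"
  using L2_add[OF assms(1) L2_scale[OF assms(2), of "-1"]] by simp

lemma L2_indicator_mult:
  assumes f: "f \<in> L2 M" and A: "A \<in> sets M"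
  shows "(\<lambda>x. indicator A x * f x) \<in> L2 M"
proof (rule L2_I)
  show "integrable M (\<lambda>x. (indicator A x * f x)\<^sup>2)"
  proof -
    have "(\<lambda>x. (indicator A x * f x)\<^sup>2) = (\<lambda>x. indicator A x *\<^sub>R (f x)\<^sup>2)"
      by (auto simp: indicator_def)
    then show ?thesis using integrable_mult_indicator[OF A L2_square_integrable[OF f]] by simp
  qed
qed (use L2_measurable[OF f] A in measurable)

lemma (in finite_measure) L2_const: "(\<lambda>_. c) \<in> L2 M"
  by (simp add: L2_def)

lemma L2_Cauchy_Schwarz:
  assumes f: "f \<in> L2 M" and g: "g \<in> L2 M"
  shows "(\<integral>x. f x * g x \<partial>M)\<^sup>2 \<le> (\<integral>x. (f x)\<^sup>2 \<partial>M) * (\<integral>x. (g x)\<^sup>2 \<partial>M)"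
proof -
  have [measurable]: "f \<in> borel_measurable M" "g \<in> borel_measurable M"
    using f g by (auto simp: L2_def)
  have eq: "(\<integral>\<^sup>+x. (ennreal \<bar>h x\<bar>)\<^sup>2 \<partial>M) = ennreal (\<integral>x. (h x)\<^sup>2 \<partial>M)" if "h \<in> L2 M" for h
    using nn_integral_eq_integral[OF L2_square_integrable[OF that]] by (simp add: ennreal_power)
  have "(\<integral>\<^sup>+x. ennreal \<bar>f x\<bar> * ennreal \<bar>g x\<bar> \<partial>M)\<^sup>2 \<le>
      (\<integral>\<^sup>+x. (ennreal \<bar>f x\<bar>)\<^sup>2 \<partial>M) * (\<integral>\<^sup>+x. (ennreal \<bar>g x\<bar>)\<^sup>2 \<partial>M)"
    by (rule Cauchy_Schwarz_nn_integral) measurable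
  also have "\<dots> = ennreal ((\<integral>x. (f x)\<^sup>2 \<partial>M) * (\<integral>x. (g x)\<^sup>2 \<partial>M))"
    by (simp add: eq f g ennreal_mult)
  also have "(\<integral>\<^sup>+x. ennreal \<bar>f x\<bar> * ennreal \<bar>g x\<bar> \<partial>M) = (\<integral>\<^sup>+x. ennreal \<bar>f x * g x\<bar> \<partial>M)"
    by (simp add: abs_mult ennreal_mult)
  also have "\<dots> = ennreal (\<integral>x. \<bar>f x * g x\<bar> \<partial>M)"
    by (intro nn_integral_eq_integral integrable_abs L2_mult_integrable f g) simp
  finally have "(\<integral>x. \<bar>f x * g x\<bar> \<partial>M)\<^sup>2 \<le> (\<integral>x. (f x)\<^sup>2 \<partial>M) * (\<integral>x. (g x)\<^sup>2 \<partial>M)"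
    by (simp add: ennreal_power)
  moreover have "\<bar>\<integral>x. f x * g x \<partial>M\<bar>\<^sup>2 \<le> (\<integral>x. \<bar>f x * g x\<bar> \<partial>M)\<^sup>2"
    by (intro power_mono integral_abs_bound) simp
  ultimately show ?thesis by simp
qed

text \<open>Continuity of the inner product. All passages to the limit in isometries and means below are
instances of it, the means with an indicator for \<open>g\<close>.\<close>

lemma L2_tendsto_integral_mult:
  assumes f: "\<And>k. f k \<in> L2 M" and f': "f' \<in> L2 M" and g: "g \<in> L2 M"
    and lim: "(\<lambda>k. \<integral>x. (f k x - f' x)\<^sup>2 \<partial>M) \<longlonglongrightarrow> 0"
  shows "(\<lambda>k. \<integral>x. f k x * g x \<partial>M) \<longlonglongrightarrow> (\<integral>x. f' x * g x \<partial>M)"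
proof -
  define d where "d k = (\<integral>x. f k x * g x \<partial>M) - (\<integral>x. f' x * g x \<partial>M)" for k
  have "(d k)\<^sup>2 \<le> (\<integral>x. (f k x - f' x)\<^sup>2 \<partial>M) * (\<integral>x. (g x)\<^sup>2 \<partial>M)" for k
    using L2_Cauchy_Schwarz[OF L2_diff[OF f[of k] f'] g]
    by (simp add: d_def left_diff_distrib L2_mult_integrable f f' g)
  moreover have "(\<lambda>k. (\<integral>x. (f k x - f' x)\<^sup>2 \<partial>M) * (\<integral>x. (g x)\<^sup>2 \<partial>M)) \<longlonglongrightarrow> 0"
    using tendsto_mult_right[OF lim] by simp
  ultimately have "(\<lambda>k. (d k)\<^sup>2) \<longlonglongrightarrow> 0"
    by (intro tendsto_sandwich[where f = "\<lambda>_. 0" and g = "\<lambda>k. (d k)\<^sup>2"] always_eventually allI)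
       auto
  then have "d \<longlonglongrightarrow> 0"
    by simp
  then show ?thesis unfolding d_def by (simp add: LIM_zero_iff)
qed

section \<open>Wiener pairs\<close>

text \<open>The graph of the Wiener integral on functions that vanish almost everywhere before time \<open>a\<close>: the
closure of the increments under linear combinations and simultaneous \<open>L\<^sup>2\<close> limits. Taking limits as a closure rule,
rather than as a second stage after step functions, lets one induction establish each property
together with its extension to the limit.\<close>

inductive wiener_pair ::
  "'a measure \<Rightarrow> (real \<Rightarrow> 'a \<Rightarrow> real) \<Rightarrow> real \<Rightarrow> (real \<Rightarrow> real) \<Rightarrow> ('a \<Rightarrow> real) \<Rightarrow> bool"
  for M B a where
  increment: "a \<le> u \<Longrightarrow> u \<le> v \<Longrightarrow>
     wiener_pair M B a (indicator {u<..v}) (\<lambda>\<omega>. B v \<omega> - B u \<omega>)"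
| add: "wiener_pair M B a f X \<Longrightarrow> wiener_pair M B a g Y \<Longrightarrow>
     wiener_pair M B a (\<lambda>s. f s + g s) (\<lambda>\<omega>. X \<omega> + Y \<omega>)"
| scale: "wiener_pair M B a f X \<Longrightarrow> wiener_pair M B a (\<lambda>s. c * f s) (\<lambda>\<omega>. c * X \<omega>)"
| limit: "(\<And>k::nat. wiener_pair M B a (\<phi> k) (Z k)) \<Longrightarrow> f \<in> L2 lborel \<Longrightarrow> X \<in> L2 M \<Longrightarrow>
     (\<lambda>k. \<integral>s. (\<phi> k s - f s)\<^sup>2 \<partial>lborel) \<longlonglongrightarrow> 0 \<Longrightarrow>
     (\<lambda>k. \<integral>\<omega>. (Z k \<omega> - X \<omega>)\<^sup>2 \<partial>M) \<longlonglongrightarrow> 0 \<Longrightarrow> wiener_pair M B a f X"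

lemma wiener_pair_diff:
  assumes "wiener_pair M B a f X" "wiener_pair M B a g Y"
  shows "wiener_pair M B a (\<lambda>s. f s - g s) (\<lambda>\<omega>. X \<omega> - Y \<omega>)"
  using wiener_pair.add[OF assms(1) wiener_pair.scale[OF assms(2), of "-1"]] by simp

lemma wiener_pair_mono: "wiener_pair M B a f X \<Longrightarrow> a' \<le> a \<Longrightarrow> wiener_pair M B a' f X"
proof (induction rule: wiener_pair.induct)
  case (limit \<phi> Z f X)
  show ?case by (rule wiener_pair.limit[of M B a' \<phi> Z f X]) (use limit in auto)
qed (auto intro: wiener_pair.intros)

context standard_brownian_motion
begin

lemma increment_mean:
  assumes "0 \<le> u" "u \<le> v"
  shows "(\<integral>\<omega>. B v \<omega> - B u \<omega> \<partial>M) = 0"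
proof (cases "u = v")
  case False
  then show ?thesis
    using assms normal_distributed_expectation[OF _ gaussian_increments[of u v]] by simp
qed simp

lemma
  assumes "0 \<le> u" "u \<le> v"
  shows increment_L2: "(\<lambda>\<omega>. B v \<omega> - B u \<omega>) \<in> L2 M"
    and increment_variance: "(\<integral>\<omega>. (B v \<omega> - B u \<omega>)\<^sup>2 \<partial>M) = v - u"
proof -
  have [measurable]: "B u \<in> borel_measurable M" "B v \<in> borel_measurable M"
    using random_variable_B assms by auto
  have "integrable M (\<lambda>\<omega>. (B v \<omega> - B u \<omega>)\<^sup>2) \<and> (\<integral>\<omega>. (B v \<omega> - B u \<omega>)\<^sup>2 \<partial>M) = v - u"
  proof (cases "u = v")
    case False
    with assms have d: "distributed M lborel (\<lambda>\<omega>. B v \<omega> - B u \<omega>) (normal_density 0 (sqrt (v - u)))"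
      and pos: "0 < sqrt (v - u)"
      using gaussian_increments[of u v] by auto
    have "integrable lborel (\<lambda>x. normal_density 0 (sqrt (v - u)) x * x\<^sup>2)"
      using integrable_normal_moment[OF pos, of 0 2] by simp
    then have "integrable M (\<lambda>\<omega>. (B v \<omega> - B u \<omega>)\<^sup>2)"
      using distributed_integrable[OF d, of "\<lambda>x. x\<^sup>2"] by simp
    moreover have "variance (\<lambda>\<omega>. B v \<omega> - B u \<omega>) = (sqrt (v - u))\<^sup>2"
      by (rule normal_distributed_variance[OF pos d])
    ultimately show ?thesis using increment_mean[OF assms] assms by simp
  qed simp
  then show "(\<lambda>\<omega>. B v \<omega> - B u \<omega>) \<in> L2 M" "(\<integral>\<omega>. (B v \<omega> - B u \<omega>)\<^sup>2 \<partial>M) = v - u"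
    by (auto intro: L2_I)
qed

text \<open>Independence enters the later arguments only through this factorisation.\<close>

lemma history_mult_increment:
  assumes uv: "0 \<le> u" "u \<le> v"
    and Z: "(Z :: 'a \<Rightarrow> real) \<in> borel_measurable (history M B {0..u})"
    and h: "h \<in> borel_measurable borel"
    and int: "integrable M Z" "integrable M (\<lambda>\<omega>. h (B v \<omega> - B u \<omega>))"
  shows "(\<integral>\<omega>. Z \<omega> * h (B v \<omega> - B u \<omega>) \<partial>M) = (\<integral>\<omega>. Z \<omega> \<partial>M) * (\<integral>\<omega>. h (B v \<omega> - B u \<omega>) \<partial>M)"
proof -
  let ?D = "\<lambda>\<omega>. B v \<omega> - B u \<omega>"
  have sub: "subalgebra M (history M B {0..u})" by (rule subalgebra_history) auto
  have [measurable]: "B u \<in> borel_measurable M" "B v \<in> borel_measurable M"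
    using random_variable_B uv by auto
  have ZM: "Z \<in> borel_measurable M" by (rule measurable_from_subalg[OF sub Z])
  have "indep_set (sigma_sets (space M) {Z -` A \<inter> space M | A. A \<in> sets borel})
    (sigma_sets (space M) {?D -` A \<inter> space M | A. A \<in> sets borel})"
    unfolding indep_set_def
  proof (rule indep_sets_mono_sets[OF history_indep_increment[OF uv, unfolded indep_set_def]])
    have "{Z -` A \<inter> space M | A. A \<in> sets borel} \<subseteq> sets (history M B {0..u})"
      using measurable_sets[OF Z] by auto
    then have "sigma_sets (space M) {Z -` A \<inter> space M | A. A \<in> sets borel} \<subseteq>
      sets (history M B {0..u})"
      using sets.sigma_sets_subset[of _ "history M B {0..u}"] by simp
    then show "(case i of True \<Rightarrow> sigma_sets (space M) {Z -` A \<inter> space M | A. A \<in> sets borel}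
        | False \<Rightarrow> sigma_sets (space M) {?D -` A \<inter> space M | A. A \<in> sets borel}) \<subseteq>
      (case i of True \<Rightarrow> sets (history M B {0..u})
        | False \<Rightarrow> sigma_sets (space M) {?D -` A \<inter> space M | A. A \<in> sets borel})" for i
      by (auto split: bool.splits)
  qed
  then have "indep_var borel Z borel ?D"
    unfolding indep_var_eq using ZM by simp
  then have "indep_var borel (id \<circ> Z) borel (h \<circ> ?D)"
    by (rule indep_var_compose) (use h in auto)
  then have "indep_var borel Z borel (\<lambda>\<omega>. h (?D \<omega>))" by (simp add: comp_def)
  from indep_var_lebesgue_integral[OF this int] show ?thesis .
qed

text \<open>For \<open>s \<le> t\<close> the later increment splits as \<open>(B s - B a) + (B t - B s)\<close>. The second summand is
centred and independent of everything up to time \<open>s\<close>, so only the variance of \<open>B s - B a\<close> remains,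
and that increment is in turn independent of \<open>F\<close>.\<close>

lemma increment_covariance_past_ordered:
  assumes F: "F \<in> sets (history M B {0..a})" and st: "0 \<le> a" "a \<le> s" "s \<le> t"
  shows "(\<integral>\<omega>. indicator F \<omega> * (B s \<omega> - B a \<omega>) * (B t \<omega> - B a \<omega>) \<partial>M) = prob F * (s - a)"
proof -
  have sub: "subalgebra M (history M B {0..r})" for r by (rule subalgebra_history) auto
  have FM: "F \<in> sets M" using F sub unfolding subalgebra_def by blast
  have Fs: "F \<in> sets (history M B {0..s})"
    using F sets_history_mono[of "{0..a}" "{0..s}" M B] st by auto
  have L: "(\<lambda>\<omega>. B s \<omega> - B a \<omega>) \<in> L2 M" "(\<lambda>\<omega>. B t \<omega> - B s \<omega>) \<in> L2 M"
    using st by (auto intro: increment_L2)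
  have int1: "integrable M (\<lambda>\<omega>. indicator F \<omega> * (B s \<omega> - B a \<omega>) * (B s \<omega> - B a \<omega>))"
    and int2: "integrable M (\<lambda>\<omega>. indicator F \<omega> * (B s \<omega> - B a \<omega>) * (B t \<omega> - B s \<omega>))"
    using L FM by (auto intro!: L2_mult_integrable L2_indicator_mult)
  have mB: "B s \<in> borel_measurable (history M B {0..s})" "B a \<in> borel_measurable (history M B {0..s})"
    using st by (auto intro!: measurable_history)
  have "(\<integral>\<omega>. indicator F \<omega> * (B s \<omega> - B a \<omega>) * (B t \<omega> - B a \<omega>) \<partial>M) =
     (\<integral>\<omega>. indicator F \<omega> * (B s \<omega> - B a \<omega>) * (B s \<omega> - B a \<omega>) +
          indicator F \<omega> * (B s \<omega> - B a \<omega>) * (B t \<omega> - B s \<omega>) \<partial>M)"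
    by (intro Bochner_Integration.integral_cong) (auto simp: algebra_simps)
  also have "\<dots> = (\<integral>\<omega>. indicator F \<omega> * (B s \<omega> - B a \<omega>)\<^sup>2 \<partial>M) +
      (\<integral>\<omega>. indicator F \<omega> * (B s \<omega> - B a \<omega>) * (B t \<omega> - B s \<omega>) \<partial>M)"
    using int1 int2 by (simp add: power2_eq_square mult.assoc)
  also have "(\<integral>\<omega>. indicator F \<omega> * (B s \<omega> - B a \<omega>)\<^sup>2 \<partial>M) = (\<integral>\<omega>. indicator F \<omega> \<partial>M) * (\<integral>\<omega>. (B s \<omega> - B a \<omega>)\<^sup>2 \<partial>M)"
    by (rule history_mult_increment[where h = "\<lambda>x. x\<^sup>2"])
       (use F FM st L(1) in \<open>auto simp: L2_square_integrable less_top[symmetric]\<close>)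
  also have "(\<integral>\<omega>. indicator F \<omega> * (B s \<omega> - B a \<omega>) * (B t \<omega> - B s \<omega>) \<partial>M) =
      (\<integral>\<omega>. indicator F \<omega> * (B s \<omega> - B a \<omega>) \<partial>M) * (\<integral>\<omega>. B t \<omega> - B s \<omega> \<partial>M)"
  proof (rule history_mult_increment[where h = "\<lambda>x. x"])
    show "(\<lambda>\<omega>. indicator F \<omega> * (B s \<omega> - B a \<omega>)) \<in> borel_measurable (history M B {0..s})"
      using Fs mB by measurable
    show "integrable M (\<lambda>\<omega>. indicator F \<omega> * (B s \<omega> - B a \<omega>))"
      using L2_mult_integrable[OF L2_indicator_mult[OF L(1) FM] L2_const[of 1]] by simp
    show "integrable M (\<lambda>\<omega>. B t \<omega> - B s \<omega>)"
      using L2_mult_integrable[OF L(2) L2_const[of 1]] by simp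
  qed (use st in auto)
  finally show ?thesis
    using increment_variance[of a s] increment_mean[of s t] FM st by simp
qed

lemma increment_covariance_past:
  assumes F: "F \<in> sets (history M B {0..a})" and st: "0 \<le> a" "a \<le> s" "a \<le> t"
  shows "(\<integral>\<omega>. indicator F \<omega> * (B s \<omega> - B a \<omega>) * (B t \<omega> - B a \<omega>) \<partial>M) = prob F * (min s t - a)"
proof (cases "s \<le> t")
  case True
  then show ?thesis using increment_covariance_past_ordered[OF F st(1,2)] by simp
next
  case False
  then show ?thesis using increment_covariance_past_ordered[OF F st(1,3), of s]
    by (simp add: mult.assoc mult.left_commute mult.commute)
qed

text \<open>By bilinearity from the covariances: the alternating sum of the four minima is the length of the
intersection of the two intervals.\<close>

lemma increment_isometry_past:
  assumes F: "F \<in> sets (history M B {0..a})"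
    and "0 \<le> a" "a \<le> u" "u \<le> v" "a \<le> x" "x \<le> y"
  shows "(\<integral>\<omega>. indicator F \<omega> * (B v \<omega> - B u \<omega>) * (B y \<omega> - B x \<omega>) \<partial>M) =
    prob F * (\<integral>s. indicator {u<..v} s * indicator {x<..y} s \<partial>lborel)"
proof -
  have sub: "subalgebra M (history M B {0..a})" by (rule subalgebra_history) auto
  have FM: "F \<in> sets M" using F sub unfolding subalgebra_def by blast
  define W where "W s \<omega> = B s \<omega> - B a \<omega>" for s \<omega>
  have int: "integrable M (\<lambda>\<omega>. indicator F \<omega> * W s \<omega> * W t \<omega>)" if "a \<le> s" "a \<le> t" for s t
    using that assms(2) FM unfolding W_def
    by (auto intro!: L2_mult_integrable L2_indicator_mult increment_L2)
  have cov: "(\<integral>\<omega>. indicator F \<omega> * W s \<omega> * W t \<omega> \<partial>M) = prob F * (min s t - a)"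
    if "a \<le> s" "a \<le> t" for s t
    unfolding W_def by (rule increment_covariance_past[OF F assms(2) that])
  have "(\<integral>\<omega>. indicator F \<omega> * (B v \<omega> - B u \<omega>) * (B y \<omega> - B x \<omega>) \<partial>M) =
    (\<integral>\<omega>. (indicator F \<omega> * W v \<omega> * W y \<omega> - indicator F \<omega> * W v \<omega> * W x \<omega>) -
       (indicator F \<omega> * W u \<omega> * W y \<omega> - indicator F \<omega> * W u \<omega> * W x \<omega>) \<partial>M)"
    by (intro Bochner_Integration.integral_cong) (auto simp: W_def algebra_simps)
  also have "\<dots> = prob F * ((min v y - min v x) - (min u y - min u x))"
    using assms int cov by (simp add: right_diff_distrib)
  also have "(min v y - min v x) - (min u y - min u x) = max 0 (min v y - max u x)"
    using assms by (auto simp: min_def max_def)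
  also have "\<dots> = (\<integral>s. indicator {u<..v} s * indicator {x<..y} s \<partial>lborel)"
  proof -
    have "{u<..v} \<inter> {x<..y} = {max u x<..min v y}" by auto
    then show ?thesis
      by (cases "max u x \<le> min v y") (auto simp: indicator_inter_arith[symmetric])
  qed
  finally show ?thesis .
qed

lemma wiener_pair_L2:
  assumes "wiener_pair M B a f X" "0 \<le> a"
  shows "f \<in> L2 lborel \<and> X \<in> L2 M"
  using assms
proof (induction rule: wiener_pair.induct)
  case (increment u v)
  have "(indicator {u<..v} :: real \<Rightarrow> real) \<in> L2 lborel"
    using increment by (auto intro!: L2_I simp: power2_eq_square indicator_inter_arith[symmetric])
  then show ?case using increment by (auto intro: increment_L2)
qed (auto intro: L2_add L2_scale)

text \<open>The two sides are continuous bilinear forms in the two pairs and agree on increments, hence on the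
closed span. Restricting to an event \<open>F\<close> of the past only scales the right-hand side by its
probability. Together with the vanishing mean this is all the independence from the past that
conditional expectations and conditional variances require.\<close>

lemma wiener_pair_isometry_past:
  assumes F: "F \<in> sets (history M B {0..a})" and a: "0 \<le> a"
    and "wiener_pair M B a f X" "wiener_pair M B a g Y"
  shows "(\<integral>\<omega>. indicator F \<omega> * X \<omega> * Y \<omega> \<partial>M) = prob F * (\<integral>s. f s * g s \<partial>lborel)"
proof -
  have sub: "subalgebra M (history M B {0..a})" by (rule subalgebra_history) auto
  have FM: "F \<in> sets M" using F sub unfolding subalgebra_def by blast
  note L2 = wiener_pair_L2[THEN conjunct1, OF _ a] wiener_pair_L2[THEN conjunct2, OF _ a]
  \<comment> \<open>Extends the identity in the second argument while the first one is held fixed. It is used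
    twice, with the roles of the two pairs exchanged by \<open>flip\<close>.\<close>
  have right: "(\<integral>\<omega>. indicator F \<omega> * X \<omega> * Y \<omega> \<partial>M) = prob F * (\<integral>s. f s * g s \<partial>lborel)"
    if X: "wiener_pair M B a f X"
      and base: "\<And>x y. a \<le> x \<Longrightarrow> x \<le> y \<Longrightarrow>
        (\<integral>\<omega>. indicator F \<omega> * X \<omega> * (B y \<omega> - B x \<omega>) \<partial>M) =
           prob F * (\<integral>s. f s * indicator {x<..y} s \<partial>lborel)"
      and Y: "wiener_pair M B a g Y" for f X g Y
    using Y
  proof (induction rule: wiener_pair.induct)
    case (increment x y)
    then show ?case by (rule base)
  next
    case (add g1 Y1 g2 Y2)
    have "integrable M (\<lambda>\<omega>. indicator F \<omega> * X \<omega> * Y1 \<omega>)"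
         "integrable M (\<lambda>\<omega>. indicator F \<omega> * X \<omega> * Y2 \<omega>)"
         "integrable lborel (\<lambda>s. f s * g1 s)" "integrable lborel (\<lambda>s. f s * g2 s)"
      using add L2 X FM by (auto intro!: L2_mult_integrable L2_indicator_mult)
    then show ?case using add.IH by (simp add: distrib_left)
  next
    case (scale g Y c)
    then show ?case by (simp add: mult.left_commute[of _ c])
  next
    case (limit \<phi> Z g Y)
    have "(\<lambda>k. \<integral>\<omega>. Z k \<omega> * (indicator F \<omega> * X \<omega>) \<partial>M) \<longlonglongrightarrow>
        (\<integral>\<omega>. Y \<omega> * (indicator F \<omega> * X \<omega>) \<partial>M)"
      by (intro L2_tendsto_integral_mult L2_indicator_mult L2(2)[OF limit.hyps(1)] L2(2)[OF X] FM
          limit.hyps)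
    moreover have "(\<lambda>k. \<integral>s. \<phi> k s * f s \<partial>lborel) \<longlonglongrightarrow> (\<integral>s. g s * f s \<partial>lborel)"
      by (intro L2_tendsto_integral_mult L2(1)[OF limit.hyps(1)] L2(1)[OF X] limit.hyps)
    then have "(\<lambda>k. prob F * (\<integral>s. \<phi> k s * f s \<partial>lborel)) \<longlonglongrightarrow> prob F * (\<integral>s. g s * f s \<partial>lborel)"
      by (rule tendsto_mult_left)
    moreover have "prob F * (\<integral>s. \<phi> k s * f s \<partial>lborel) = (\<integral>\<omega>. Z k \<omega> * (indicator F \<omega> * X \<omega>) \<partial>M)" for k
      using limit.IH[of k] by (simp add: mult_ac)
    ultimately have "(\<integral>\<omega>. Y \<omega> * (indicator F \<omega> * X \<omega>) \<partial>M) = prob F * (\<integral>s. g s * f s \<partial>lborel)"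
      by (simp add: LIMSEQ_unique)
    then show ?case by (simp add: mult_ac)
  qed
  have flip: "(\<integral>\<omega>. indicator F \<omega> * X \<omega> * Y \<omega> \<partial>M) = prob F * (\<integral>s. f s * g s \<partial>lborel)"
    if "(\<integral>\<omega>. indicator F \<omega> * Y \<omega> * X \<omega> \<partial>M) = prob F * (\<integral>s. g s * f s \<partial>lborel)" for f g X Y
    using that by (simp add: mult_ac)
  show ?thesis
  proof (rule right[OF assms(3) _ assms(4)])
    fix x y assume xy: "a \<le> x" "x \<le> y"
    show "(\<integral>\<omega>. indicator F \<omega> * X \<omega> * (B y \<omega> - B x \<omega>) \<partial>M) =
        prob F * (\<integral>s. f s * indicator {x<..y} s \<partial>lborel)"
      by (rule flip, rule right[OF wiener_pair.increment[OF xy] _ assms(3)],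
          rule increment_isometry_past[OF F a xy])
  qed
qed

lemma wiener_pair_mean_past:
  assumes F: "F \<in> sets (history M B {0..a})" and a: "0 \<le> a"
    and "wiener_pair M B a f X"
  shows "(\<integral>\<omega>. indicator F \<omega> * X \<omega> \<partial>M) = 0"
  using assms(3)
proof (induction rule: wiener_pair.induct)
  have sub: "subalgebra M (history M B {0..r})" for r by (rule subalgebra_history) auto
  have FM: "F \<in> sets M" using F sub unfolding subalgebra_def by blast
  note L2 = wiener_pair_L2[THEN conjunct2, OF _ a]
  have int: "integrable M (\<lambda>\<omega>. indicator F \<omega> * X \<omega>)" if "X \<in> L2 M" for X
    using L2_mult_integrable[OF L2_indicator_mult[OF that FM] L2_const[of 1]] by simp
  {
    case (increment u v)
    have "F \<in> sets (history M B {0..u})"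
      using F sets_history_mono[of "{0..a}" "{0..u}" M B] increment by auto
    moreover have "integrable M (\<lambda>\<omega>. B v \<omega> - B u \<omega>)"
      using L2_mult_integrable[OF increment_L2 L2_const[of 1], of u v] increment a by simp
    ultimately have "(\<integral>\<omega>. indicator F \<omega> * (B v \<omega> - B u \<omega>) \<partial>M) =
        (\<integral>\<omega>. indicator F \<omega> \<partial>M) * (\<integral>\<omega>. B v \<omega> - B u \<omega> \<partial>M)"
      using increment a FM
      by (intro history_mult_increment[where h = "\<lambda>x. x"]) (auto simp: less_top[symmetric])
    then show ?case using increment_mean[of u v] increment a by simp
  next
    case (add f X g Y)
    then show ?case using int[OF L2[OF add(1)]] int[OF L2[OF add(2)]] by (simp add: distrib_left)
  next
    case (scale f X c)
    then show ?case by (simp add: mult.left_commute[of _ c])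
  next
    case (limit \<phi> Z f X)
    have "(\<lambda>k. \<integral>\<omega>. Z k \<omega> * (indicator F \<omega> * 1) \<partial>M) \<longlonglongrightarrow> (\<integral>\<omega>. X \<omega> * (indicator F \<omega> * 1) \<partial>M)"
      by (intro L2_tendsto_integral_mult L2_indicator_mult L2_const L2[OF limit.hyps(1)] FM
          limit.hyps)
    with limit.IH show ?case by (simp add: mult.commute LIMSEQ_const_iff)
  }
qed

lemma wiener_pair_isometry:
  assumes "wiener_pair M B a f X" "0 \<le> a"
  shows "(\<integral>\<omega>. (X \<omega>)\<^sup>2 \<partial>M) = (\<integral>s. (f s)\<^sup>2 \<partial>lborel)"
proof -
  have "space M \<in> sets (history M B {0..a})"
    by (metis sets.top space_history)
  from wiener_pair_isometry_past[OF this assms(2,1,1)]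
  have "(\<integral>\<omega>. indicator (space M) \<omega> * X \<omega> * X \<omega> \<partial>M) = (\<integral>s. f s * f s \<partial>lborel)"
    by (simp add: prob_space)
  moreover have "(\<integral>\<omega>. indicator (space M) \<omega> * X \<omega> * X \<omega> \<partial>M) = (\<integral>\<omega>. X \<omega> * X \<omega> \<partial>M)"
    by (intro Bochner_Integration.integral_cong) auto
  ultimately show ?thesis by (simp add: power2_eq_square)
qed


text \<open>The difference of the two pairs is a Wiener pair of a null function, and the isometry makes its
random variable a null function too.\<close>

lemma wiener_pair_unique:
  assumes X: "wiener_pair M B a f X" and Y: "wiener_pair M B a g Y" and a: "0 \<le> a"
    and fg: "AE s in lborel. f s = g s"
  shows "AE \<omega> in M. X \<omega> = Y \<omega>"
proof -
  note D = wiener_pair_diff[OF X Y]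
  note E = wiener_pair_L2[OF D a]
  have L: "(\<lambda>\<omega>. X \<omega> - Y \<omega>) \<in> L2 M" 
    using E by blast
  have "AE s in lborel. (f s - g s)\<^sup>2 = 0" using fg by eventually_elim simp
  then have "(\<integral>s. (f s - g s)\<^sup>2 \<partial>lborel) = 0" by (rule integral_eq_zero_AE)
  then have "(\<integral>\<omega>. (X \<omega> - Y \<omega>)\<^sup>2 \<partial>M) = 0"
    unfolding wiener_pair_isometry[OF D a] .
  then have "AE \<omega> in M. (X \<omega> - Y \<omega>)\<^sup>2 = 0"
    using integral_nonneg_eq_0_iff_AE[OF L2_square_integrable[OF L]] by simp
  then show ?thesis by eventually_elim simp
qed
end

section \<open>Existence of the Ito integral\<close>

lemma L2_nn_integral_square:
  "f \<in> L2 M \<Longrightarrow> (\<integral>\<^sup>+x. ennreal ((f x)\<^sup>2) \<partial>M) = ennreal (\<integral>x. (f x)\<^sup>2 \<partial>M)"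
  by (intro nn_integral_eq_integral L2_square_integrable) auto

text \<open>A form of the Riesz-Fischer theorem that keeps track of the sub-sigma-algebra. The geometric rate
makes the successive differences summable in \<open>L\<^sup>1\<close>, so the sequence converges almost surely. Its
pointwise \<open>lim\<close> is measurable for \<open>G\<close>, also off the set of convergence, and
Fatou's lemma turns the almost sure limit into an \<open>L\<^sup>2\<close> limit.\<close>

lemma (in prob_space) L2_limit_of_rapidly_Cauchy:
  assumes sub: "subalgebra M G"
    and XG: "\<And>k. X k \<in> borel_measurable G" and XL: "\<And>k. X k \<in> L2 M"
    and cauchy: "\<And>j k. k \<le> j \<Longrightarrow> (\<integral>x. (X j x - X k x)\<^sup>2 \<partial>M) \<le> C * (1/4) ^ k"
  obtains Y where "Y \<in> borel_measurable G" "Y \<in> L2 M" "(\<lambda>k. \<integral>x. (X k x - Y x)\<^sup>2 \<partial>M) \<longlonglongrightarrow> 0"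
proof -
  have XM [measurable]: "X k \<in> borel_measurable M" for k
    using XL by (rule L2_measurable)
  have "(\<integral>x. (X 0 x - X 0 x)\<^sup>2 \<partial>M) \<le> C * (1/4) ^ 0" by (rule cauchy) simp
  then have C: "0 \<le> C" by simp
  have step: "(\<integral>x. \<bar>X (Suc k) x - X k x\<bar> \<partial>M) \<le> sqrt C * (1/2) ^ k" for k
  proof -
    have L: "(\<lambda>x. \<bar>X (Suc k) x - X k x\<bar>) \<in> L2 M"
      using L2_diff[OF XL[of "Suc k"] XL[of k]] by (auto simp: L2_def)
    have "(\<integral>x. \<bar>X (Suc k) x - X k x\<bar> \<partial>M)\<^sup>2 \<le> (\<integral>x. (X (Suc k) x - X k x)\<^sup>2 \<partial>M)"
      using L2_Cauchy_Schwarz[OF L L2_const[of 1]] by (simp add: prob_space)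
    also have "\<dots> \<le> C * (1/4) ^ k" by (rule cauchy) simp
    also have "\<dots> = (sqrt C * (1/2) ^ k)\<^sup>2"
    proof -
      have "((1/2 :: real) ^ k)\<^sup>2 = (1/4) ^ k"
        by (simp add: power2_eq_square flip: power_mult_distrib)
      then show ?thesis using C by (simp add: power_mult_distrib)
    qed
    finally show ?thesis
      by (rule power2_le_imp_le) (use C in simp)
  qed
  have int: "integrable M (\<lambda>x. \<bar>X (Suc k) x - X k x\<bar>)" for k
    using L2_mult_integrable[OF L2_diff[OF XL[of "Suc k"] XL[of k]] L2_const[of 1]] by simp
  have "(\<integral>\<^sup>+x. (\<Sum>k. ennreal \<bar>X (Suc k) x - X k x\<bar>) \<partial>M) =
      (\<Sum>k. \<integral>\<^sup>+x. ennreal \<bar>X (Suc k) x - X k x\<bar> \<partial>M)"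
    by (intro nn_integral_suminf) measurable
  also have "\<dots> = (\<Sum>k. ennreal (\<integral>x. \<bar>X (Suc k) x - X k x\<bar> \<partial>M))"
    by (intro suminf_cong nn_integral_eq_integral int) auto
  also have "\<dots> \<le> (\<Sum>k. ennreal (sqrt C * (1/2) ^ k))"
    by (intro suminf_le summableI ennreal_leI step)
  also have "\<dots> = ennreal (\<Sum>k. sqrt C * (1/2) ^ k)"
    using C by (intro suminf_ennreal2 summable_mult summable_geometric) auto
  finally have fin: "(\<integral>\<^sup>+x. (\<Sum>k. ennreal \<bar>X (Suc k) x - X k x\<bar>) \<partial>M) \<noteq> \<infinity>"
    by (auto simp: top_unique)
  have "AE x in M. (\<Sum>k. ennreal \<bar>X (Suc k) x - X k x\<bar>) \<noteq> \<infinity>"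
    by (rule nn_integral_PInf_AE[OF _ fin]) measurable
  then have conv: "AE x in M. convergent (\<lambda>k. X k x)"
  proof eventually_elim
    case (elim x)
    then have "summable (\<lambda>k. \<bar>X (Suc k) x - X k x\<bar>)"
      by (intro summable_suminf_not_top) auto
    then have "summable (\<lambda>k. X (Suc k) x - X k x)"
      by (rule summable_rabs_cancel)
    then have "convergent (\<lambda>n. (\<Sum>k<n. X (Suc k) x - X k x) + X 0 x)"
      by (intro convergent_add convergent_const) (simp add: summable_iff_convergent)
    moreover have "(\<Sum>k<n. X (Suc k) x - X k x) + X 0 x = X n x" for n
      by (induction n) auto
    ultimately show ?case by simp
  qed
  define Y where "Y x = lim (\<lambda>k. X k x)" for x
  have YG: "Y \<in> borel_measurable G"
    unfolding Y_def using XG by (intro borel_measurable_lim_metric)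
  have YM [measurable]: "Y \<in> borel_measurable M"
    by (rule measurable_from_subalg[OF sub YG])
  have le: "(\<integral>\<^sup>+x. ennreal ((X k x - Y x)\<^sup>2) \<partial>M) \<le> ennreal (C * (1/4) ^ k)" for k
  proof -
    have "(\<integral>\<^sup>+x. ennreal ((X k x - Y x)\<^sup>2) \<partial>M) =
        (\<integral>\<^sup>+x. liminf (\<lambda>j. ennreal ((X j x - X k x)\<^sup>2)) \<partial>M)"
    proof (rule nn_integral_cong_AE, use conv in eventually_elim)
      case (elim x)
      then have "(\<lambda>j. X j x) \<longlonglongrightarrow> Y x" by (simp add: Y_def convergent_LIMSEQ_iff)
      then have e: "(\<lambda>j. ennreal ((X j x - X k x)\<^sup>2)) \<longlonglongrightarrow> ennreal ((Y x - X k x)\<^sup>2)"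
        by (intro tendsto_ennrealI tendsto_power tendsto_diff tendsto_const)
      show ?case
        unfolding lim_imp_Liminf[OF sequentially_bot e] by (simp only: power2_commute)
    qed
    also have "\<dots> \<le> liminf (\<lambda>j. \<integral>\<^sup>+x. ennreal ((X j x - X k x)\<^sup>2) \<partial>M)"
      by (intro nn_integral_liminf) measurable
    also have "\<dots> \<le> ennreal (C * (1/4) ^ k)"
    proof (rule Liminf_le)
      show "\<forall>\<^sub>F j in sequentially. (\<integral>\<^sup>+x. ennreal ((X j x - X k x)\<^sup>2) \<partial>M) \<le> ennreal (C * (1/4) ^ k)"
        using eventually_ge_at_top[of k]
        by eventually_elim
           (simp only: L2_nn_integral_square[OF L2_diff[OF XL XL]] ennreal_leI[OF cauchy])
    qed simp
    finally show ?thesis .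
  qed
  have D: "(\<lambda>x. X k x - Y x) \<in> L2 M" for k
    using order.strict_trans1[OF le[of k] ennreal_less_top]
    by (intro L2_I integrableI_bounded) auto
  have YL: "Y \<in> L2 M"
    using L2_diff[OF XL[of 0] D[of 0]] by simp
  have bound: "(\<integral>x. (X k x - Y x)\<^sup>2 \<partial>M) \<le> C * (1/4) ^ k" for k
    using le[of k] C unfolding L2_nn_integral_square[OF D] by (subst (asm) ennreal_le_iff) auto
  have "(\<lambda>k. C * (1/4) ^ k) \<longlonglongrightarrow> C * 0"
    by (intro tendsto_mult tendsto_const LIMSEQ_power_zero) simp
  then have zero: "(\<lambda>k. C * (1/4) ^ k) \<longlonglongrightarrow> 0" by simp
  have "(\<lambda>k. \<integral>x. (X k x - Y x)\<^sup>2 \<partial>M) \<longlonglongrightarrow> 0"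
  proof (rule tendsto_sandwich[OF _ _ tendsto_const zero])
    show "\<forall>\<^sub>F k in sequentially. 0 \<le> (\<integral>x. (X k x - Y x)\<^sup>2 \<partial>M)"
      by (intro always_eventually allI integral_nonneg) simp
    show "\<forall>\<^sub>F k in sequentially. (\<integral>x. (X k x - Y x)\<^sup>2 \<partial>M) \<le> C * (1/4) ^ k"
      by (intro always_eventually allI bound)
  qed
  with that YG YL show ?thesis by blast
qed

lemma is_partition_mono:
  assumes "is_partition a b n p" "i \<le> j" "j \<le> n"
  shows "p i \<le> p j"
  using assms(2,3)
proof (induction rule: dec_induct)
  case (step m)
  then show ?case using assms(1) unfolding is_partition_def by (metis Suc_leD Suc_le_lessD order.trans)
qed simp

lemma is_partition_bounds:
  assumes "is_partition a b n p" "i \<le> n"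
  shows "a \<le> p i" "p i \<le> b"
proof -
  have "p 0 = a" "p n = b" using assms(1) unfolding is_partition_def by blast+
  then show "a \<le> p i" "p i \<le> b"
    using is_partition_mono[OF assms(1), of 0 i] is_partition_mono[OF assms(1), of i n] assms(2)
    by auto
qed

lemma step_function_eq:
  assumes p: "is_partition a b n p" and i: "i < n" and s: "s \<in> {p i<..p (Suc i)}"
  shows "step_function n p c s = c i"
proof -
  have "c j * indicator {p j<..p (Suc j)} s = (if j = i then c i else 0)" if "j < n" for j
  proof (cases j i rule: linorder_cases)
    case less
    then show ?thesis using is_partition_mono[OF p, of "Suc j" i] i s by (auto simp: indicator_def)
  next
    case greater
    then show ?thesis using is_partition_mono[OF p, of "Suc i" j] that s by (auto simp: indicator_def)
  qed (use s in simp)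
  then have "step_function n p c s = (\<Sum>j<n. if j = i then c i else 0)"
    unfolding step_function_def by (intro sum.cong) auto
  then show ?thesis using i by simp
qed

lemma step_function_outside:
  assumes p: "is_partition a b n p" and "s \<notin> {a<..b}"
  shows "step_function n p c s = 0"
  unfolding step_function_def
proof (intro sum.neutral ballI)
  fix i assume "i \<in> {..<n}"
  then show "c i * indicator {p i<..p (Suc i)} s = 0"
    using is_partition_bounds[OF p, of i] is_partition_bounds[OF p, of "Suc i"] assms(2)
    by (auto simp: indicator_def)
qed

lemma is_partition_covers:
  assumes p: "is_partition a b n p" and s: "s \<in> {a<..b}"
  obtains i where "i < n" "s \<in> {p i<..p (Suc i)}"
proof -
  define i where "i = (LEAST i. s \<le> p i)"
  have "s \<le> p n" using p s by (simp add: is_partition_def)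
  then have i: "s \<le> p i" "i \<le> n" unfolding i_def by (auto intro: LeastI Least_le)
  moreover have "i \<noteq> 0" using i(1) p s by (metis greaterThanAtMost_iff is_partition_def not_le)
  moreover then have "\<not> s \<le> p (i - 1)" unfolding i_def by (intro not_less_Least) simp
  ultimately show ?thesis using that[of "i - 1"] by auto
qed

lemma step_wiener_pair:
  assumes p: "is_partition a b n p"
  shows "wiener_pair M B a (step_function n p c) (step_integral B n p c)"
proof -
  have "wiener_pair M B a (\<lambda>s. \<Sum>i<m. c i * indicator {p i<..p (Suc i)} s)
      (\<lambda>\<omega>. \<Sum>i<m. c i * (B (p (Suc i)) \<omega> - B (p i) \<omega>))" if "m \<le> n" for m
    using that
  proof (induction m)
    case 0
    show ?case using wiener_pair.scale[OF wiener_pair.increment[of a a a M B], of 0] by simp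
  next
    case (Suc m)
    have "a \<le> p m" "p m \<le> p (Suc m)"
      using is_partition_bounds[OF p, of m] is_partition_mono[OF p, of m "Suc m"] Suc.prems by auto
    then show ?case
      using Suc by (auto intro!: wiener_pair.add wiener_pair.scale wiener_pair.increment)
  qed
  from this[of n] show ?thesis
    by (simp add: step_function_def[abs_def] step_integral_def[abs_def])
qed

context standard_brownian_motion
begin

text \<open>Elementary integrals of step functions are Wiener pairs, and the approximation in the definition
of the Ito integral is the limit rule, once the integrand is extended by zero outside \<open>[a, b]\<close>.\<close>

lemma ito_wiener_pair:
  assumes ito: "has_ito_integral M B a b f X" and a: "0 \<le> a"
    and f: "(\<lambda>s. indicator {a..b} s * f s) \<in> L2 lborel"
  shows "wiener_pair M B a (\<lambda>s. indicator {a..b} s * f s) X"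
proof -
  obtain n p c where part: "\<And>k. is_partition a b (n k) (p k)"
    and lim1: "(\<lambda>k. \<integral>\<^sup>+s\<in>{a..b}. ennreal ((f s - step_function (n k) (p k) (c k) s)\<^sup>2) \<partial>lborel) \<longlonglongrightarrow> 0"
    and lim2: "(\<lambda>k. \<integral>\<^sup>+\<omega>. ennreal ((X \<omega> - step_integral B (n k) (p k) (c k) \<omega>)\<^sup>2) \<partial>M) \<longlonglongrightarrow> 0"
    using ito unfolding has_ito_integral_def by blast
  let ?\<phi> = "\<lambda>k. step_function (n k) (p k) (c k)" and ?Z = "\<lambda>k. step_integral B (n k) (p k) (c k)"
  let ?f = "\<lambda>s. indicator {a..b} s * f s"
  have XL: "X \<in> L2 M" using ito by (auto simp: has_ito_integral_def L2_def)
  have w: "wiener_pair M B a (?\<phi> k) (?Z k)" for k by (rule step_wiener_pair[OF part])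
  have L: "?\<phi> k \<in> L2 lborel" "?Z k \<in> L2 M" for k using wiener_pair_L2[OF w a] by auto
  have "ennreal ((f s - ?\<phi> k s)\<^sup>2) * indicator {a..b} s = ennreal ((?\<phi> k s - ?f s)\<^sup>2)" for k s
    using step_function_outside[OF part[of k], of s "c k"]
    by (auto simp: indicator_def power2_commute)
  then have "(\<lambda>k. ennreal (\<integral>s. (?\<phi> k s - ?f s)\<^sup>2 \<partial>lborel)) \<longlonglongrightarrow> 0"
    using lim1 by (simp add: L2_nn_integral_square[OF L2_diff[OF L(1) f]])
  moreover have "(\<lambda>k. ennreal (\<integral>\<omega>. (?Z k \<omega> - X \<omega>)\<^sup>2 \<partial>M)) \<longlonglongrightarrow> 0"
    using lim2 unfolding L2_nn_integral_square[OF L2_diff[OF XL L(2)]]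
    by (simp only: power2_commute)
  ultimately show ?thesis
    by (intro wiener_pair.limit[of M B a ?\<phi> ?Z, OF w f XL]) (simp_all add: ennreal_tendsto_0_iff)
qed

end

text \<open>The integrand may be unbounded at \<open>b\<close>, as the kernel \<open>(b - s)\<^bsup>h - 1/2\<^esup>\<close> is for \<open>h < 1/2\<close>. It is cut off
at some \<open>t < b\<close> beyond which its square has little mass, and on \<open>[a, t]\<close> it is uniformly
continuous, so a fine equidistant partition suffices. The vanishing of the coefficients near \<open>b\<close> is
what later keeps the approximating integrals measurable for the strict past of \<open>b\<close>.\<close>

lemma L2_step_approximation:
  fixes f :: "real \<Rightarrow> real"
  assumes ab: "a \<le> b" and cont: "continuous_on {a..<b} f"
    and f: "(\<lambda>s. indicator {a..b} s * f s) \<in> L2 lborel" and e: "0 < e"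
  obtains n p c where "is_partition a b n p" "\<forall>i<n. c i \<noteq> 0 \<longrightarrow> p (Suc i) < b"
    "(\<integral>s. (indicator {a..b} s * f s - step_function n p c s)\<^sup>2 \<partial>lborel) < e"
proof (cases "a = b")
  case True
  have "AE s in lborel. (indicator {a..b} s * f s - step_function 0 (\<lambda>_. a) (\<lambda>_. 0) s)\<^sup>2 = 0"
    using AE_lborel_singleton[of a] by eventually_elim (auto simp: True step_function_def)
  then have "(\<integral>s. (indicator {a..b} s * f s - step_function 0 (\<lambda>_. a) (\<lambda>_. 0) s)\<^sup>2 \<partial>lborel) = 0"
    by (rule integral_eq_zero_AE)
  with that[of 0 "\<lambda>_. a" "\<lambda>_. 0"] e True show ?thesis by (simp add: is_partition_def)
next
  case False
  with ab have ab: "a < b" by simp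
  define g where "g s = indicator {a..b} s * f s" for s
  have g: "g \<in> L2 lborel" using f by (simp add: g_def[abs_def])
  note [measurable] = L2_measurable[OF g]
  define d where "d n = b - (b - a) / Suc n" for n
  have "(\<lambda>n. \<integral>s. indicator {d n<..} s * (g s)\<^sup>2 \<partial>lborel) \<longlonglongrightarrow> (\<integral>s. 0 \<partial>(lborel :: real measure))"
  proof (rule integral_dominated_convergence[where w = "\<lambda>s. (g s)\<^sup>2"])
    show "AE s in lborel. (\<lambda>n. indicator {d n<..} s * (g s)\<^sup>2) \<longlonglongrightarrow> 0"
      using AE_lborel_singleton[of b]
    proof eventually_elim
      case (elim s)
      show ?case
      proof (cases "s < b")
        case True
        have "d \<longlonglongrightarrow> b - 0"
          unfolding d_def by (intro tendsto_diff tendsto_const lim_const_over_n[THEN LIMSEQ_Suc])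
        then have "\<forall>\<^sub>F n in sequentially. s < d n"
          using True by (intro order_tendstoD(1)[of d b]) auto
        then have "\<forall>\<^sub>F n in sequentially. indicator {d n<..} s * (g s)\<^sup>2 = 0"
          by eventually_elim auto
        then show ?thesis by (rule tendsto_eventually)
      next
        case False
        with elim show ?thesis by (simp add: g_def)
      qed
    qed
  qed (use L2_square_integrable[OF g] in \<open>auto simp: indicator_def\<close>)
  then have "\<forall>\<^sub>F n in sequentially. (\<integral>s. indicator {d n<..} s * (g s)\<^sup>2 \<partial>lborel) < e / 2"
    using e by (intro order_tendstoD(2)[of _ 0]) auto
  then obtain m where m: "(\<integral>s. indicator {d m<..} s * (g s)\<^sup>2 \<partial>lborel) < e / 2"
    by (auto simp: eventually_sequentially)
  define t where "t = d m"
  have "(b - a) / Suc m \<le> (b - a) / 1" using ab by (intro divide_left_mono) auto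
  moreover have "0 < (b - a) / Suc m" using ab by simp
  ultimately have t: "a \<le> t" "t < b" using ab by (auto simp: t_def d_def)
  define \<eta> where "\<eta> = sqrt (e / (2 * (b - a)))"
  have \<eta>: "0 < \<eta>" "\<eta>\<^sup>2 * (b - a) = e / 2" using e ab by (auto simp: \<eta>_def field_simps)
  have "uniformly_continuous_on {a..t} f"
    using t by (intro compact_uniformly_continuous continuous_on_subset[OF cont]) auto
  then obtain \<delta> where \<delta>: "0 < \<delta>"
    "\<And>s s'. s \<in> {a..t} \<Longrightarrow> s' \<in> {a..t} \<Longrightarrow> \<bar>s' - s\<bar> < \<delta> \<Longrightarrow> \<bar>f s' - f s\<bar> < \<eta>"
    using \<eta>(1) unfolding uniformly_continuous_on_def dist_real_def by metis
  obtain N0 where N0: "(t - a) / \<delta> < real N0" using reals_Archimedean2 by blast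
  define N where "N = Suc N0"
  have N: "0 < N" "(t - a) / N < \<delta>"
    using N0 \<delta>(1) by (auto simp: N_def field_simps)
  \<comment> \<open>\<open>N\<close> equal intervals on \<open>[a, t]\<close>, and the interval \<open>(t, b]\<close> with coefficient zero.\<close>
  define p where "p i = (if i \<le> N then a + i * ((t - a) / N) else b)" for i
  define c where "c i = (if i < N then f (p i) else 0)" for i
  have pN: "p N = t" using N by (simp add: p_def)
  have part: "is_partition a b (Suc N) p"
    unfolding is_partition_def
  proof (intro conjI allI impI)
    show "p i \<le> p (Suc i)" if "i < Suc N" for i
    proof (cases "i < N")
      case True
      then show ?thesis using t by (auto simp: p_def intro!: divide_right_mono mult_right_mono)
    next
      case False
      with that have "i = N" by simp
      then show ?thesis using pN t by (simp add: p_def)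
    qed
  qed (auto simp: p_def)
  have pt: "p i \<le> t" if "i \<le> N" for i
    using is_partition_mono[OF part, of i N] that pN by simp
  let ?\<phi> = "step_function (Suc N) p c"
  have \<phi>: "?\<phi> \<in> L2 lborel"
  proof -
    have "(\<lambda>s. c i * indicator {p i<..p (Suc i)} s) \<in> L2 lborel" for i
      by (cases "p i \<le> p (Suc i)"; intro L2_scale L2_I)
         (auto simp: power2_eq_square indicator_inter_arith[symmetric])
    then have "(\<lambda>s. \<Sum>i<m. c i * indicator {p i<..p (Suc i)} s) \<in> L2 lborel" for m
    proof (induction m)
      case (Suc m)
      show ?case unfolding sum.lessThan_Suc by (rule L2_add[OF Suc.IH[OF Suc.prems] Suc.prems])
    qed (simp add: L2_def)
    then show ?thesis by (simp add: step_function_def[abs_def])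
  qed
  have ptw: "(g s - ?\<phi> s)\<^sup>2 \<le> indicator {a..t} s * \<eta>\<^sup>2 + indicator {d m<..} s * (g s)\<^sup>2" if "s \<noteq> a" for s
  proof (cases "s \<in> {a<..b}")
    case False
    then show ?thesis using step_function_outside[OF part False] that by (auto simp: g_def)
  next
    case True
    then obtain i where i: "i < Suc N" "s \<in> {p i<..p (Suc i)}"
      by (rule is_partition_covers[OF part])
    have \<phi>s: "?\<phi> s = c i" by (rule step_function_eq[OF part i])
    show ?thesis
    proof (cases "i < N")
      case True
      have "p (Suc i) - p i = (t - a) / N"
        using True by (simp add: p_def algebra_simps add_divide_distrib diff_divide_distrib)
      then have "\<bar>s - p i\<bar> < \<delta>" using i N by auto
      moreover have "s \<in> {a..t}" "p i \<in> {a..t}"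
        using i True pt[of "Suc i"] pt[of i] is_partition_bounds[OF part, of i] by auto
      ultimately have "\<bar>f s - f (p i)\<bar> < \<eta>" by (intro \<delta>(2))
      then have "(f s - f (p i))\<^sup>2 \<le> \<eta>\<^sup>2"
        by (metis abs_ge_zero less_imp_le power2_abs power_mono)
      moreover have "g s - ?\<phi> s = f s - f (p i)"
        using \<open>s \<in> {a..t}\<close> t True by (auto simp: g_def \<phi>s c_def)
      ultimately show ?thesis using \<open>s \<in> {a..t}\<close> by (auto simp: indicator_def add_increasing2)
    next
      case False
      then have "i = N" using i by simp
      then have "t < s" using i pN by simp
      then show ?thesis using False by (simp add: \<phi>s c_def t_def)
    qed
  qed
  have int: "integrable lborel (\<lambda>s. indicator {a..t} s * \<eta>\<^sup>2)"
    "integrable lborel (\<lambda>s. indicator {d m<..} s * (g s)\<^sup>2)"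
    using integrable_mult_indicator[of "{d m<..}" lborel, OF _ L2_square_integrable[OF g]]
    using t by (auto intro!: integrable_mult_left)
  have "(\<integral>s. (g s - ?\<phi> s)\<^sup>2 \<partial>lborel) \<le>
      (\<integral>s. indicator {a..t} s * \<eta>\<^sup>2 + indicator {d m<..} s * (g s)\<^sup>2 \<partial>lborel)"
  proof (rule integral_mono_AE)
    show "AE s in lborel. (g s - ?\<phi> s)\<^sup>2 \<le> indicator {a..t} s * \<eta>\<^sup>2 + indicator {d m<..} s * (g s)\<^sup>2"
      using AE_lborel_singleton[of a] by eventually_elim (rule ptw)
  qed (use int L2_square_integrable[OF L2_diff[OF g \<phi>]] in auto)
  also have "\<dots> = (t - a) * \<eta>\<^sup>2 + (\<integral>s. indicator {d m<..} s * (g s)\<^sup>2 \<partial>lborel)"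
    using int t by simp
  also have "\<dots> < (b - a) * \<eta>\<^sup>2 + e / 2"
    using t m by (intro add_le_less_mono mult_right_mono) auto
  also have "\<dots> = e" using \<eta> by (simp add: mult.commute)
  finally have "(\<integral>s. (g s - ?\<phi> s)\<^sup>2 \<partial>lborel) < e" .
  moreover have "p (Suc i) < b" if "i < Suc N" "c i \<noteq> 0" for i
    using that pt[of "Suc i"] t by (auto simp: c_def split: if_splits)
  ultimately show ?thesis
    using that[OF part] by (auto simp: g_def)
qed

context standard_brownian_motion
begin

text \<open>A step function whose coefficients vanish on the intervals that reach \<open>b\<close> has an integral that
involves \<open>B\<close> only at times before \<open>b\<close>. The isometry turns fast \<open>L\<^sup>2\<close> convergence of such step functions
into fast convergence of their integrals, and the limit inherits their measurability.\<close>

lemma ex_ito_integral_past_measurable: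
  assumes ab: "0 \<le> a" "a \<le> b" and cont: "continuous_on {a..<b} f"
    and f: "(\<lambda>s. indicator {a..b} s * f s) \<in> L2 lborel"
  obtains X where "X \<in> borel_measurable (strict_past M B b)" "has_ito_integral M B a b f X"
proof -
  let ?G = "strict_past M B b" and ?f = "\<lambda>s. indicator {a..b} s * f s"
  define Q where "Q k n p c \<longleftrightarrow> is_partition a b n p \<and> (\<forall>i<n. c i \<noteq> 0 \<longrightarrow> p (Suc i) < b) \<and>
      (\<integral>s. (?f s - step_function n p c s)\<^sup>2 \<partial>lborel) < (1/4) ^ k" for k n p c
  have "\<forall>k. \<exists>n p c. Q k n p c"
  proof
    fix k
    have "(0 :: real) < (1/4) ^ k" by simp
    then show "\<exists>n p c. Q k n p c"
      by (rule L2_step_approximation[OF ab(2) cont f]) (unfold Q_def, intro exI conjI)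
  qed
  then obtain n p c where Q: "\<And>k. Q k (n k) (p k) (c k)" by metis
  have part: "\<And>k. is_partition a b (n k) (p k)"
    and supp: "\<And>k i. i < n k \<Longrightarrow> c k i \<noteq> 0 \<Longrightarrow> p k (Suc i) < b"
    and close: "\<And>k. (\<integral>s. (?f s - step_function (n k) (p k) (c k) s)\<^sup>2 \<partial>lborel) < (1/4) ^ k"
    using Q by (simp_all add: Q_def)
  let ?\<phi> = "\<lambda>k. step_function (n k) (p k) (c k)" and ?Z = "\<lambda>k. step_integral B (n k) (p k) (c k)"
  have sub: "subalgebra M ?G"
    unfolding strict_past_eq_history by (rule subalgebra_history) auto
  have w: "wiener_pair M B a (?\<phi> k) (?Z k)" for k by (rule step_wiener_pair[OF part])
  have L: "?\<phi> k \<in> L2 lborel" "?Z k \<in> L2 M" for k using wiener_pair_L2[OF w ab(1)] by auto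
  have ZG: "?Z k \<in> borel_measurable ?G" for k
    unfolding step_integral_def
  proof (rule borel_measurable_sum)
    fix i assume "i \<in> {..<n k}"
    then have i: "i < n k" by simp
    show "(\<lambda>\<omega>. c k i * (B (p k (Suc i)) \<omega> - B (p k i) \<omega>)) \<in> borel_measurable ?G"
    proof (cases "c k i = 0")
      case False
      then have "p k (Suc i) < b" using supp i by blast
      moreover have "0 \<le> p k i" "p k i \<le> p k (Suc i)"
        using is_partition_bounds[OF part[of k], of i] is_partition_mono[OF part[of k], of i "Suc i"] i ab
        by auto
      ultimately have "p k i \<in> {0..<b}" "p k (Suc i) \<in> {0..<b}" by auto
      then show ?thesis
        unfolding strict_past_eq_history
        by (intro borel_measurable_times borel_measurable_diff measurable_history borel_measurable_const)
    qed simp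
  qed
  have cauchy: "(\<integral>\<omega>. (?Z j \<omega> - ?Z k \<omega>)\<^sup>2 \<partial>M) \<le> 4 * (1/4) ^ k" if "k \<le> j" for j k
  proof -
    have "(\<integral>\<omega>. (?Z j \<omega> - ?Z k \<omega>)\<^sup>2 \<partial>M) = (\<integral>s. (?\<phi> j s - ?\<phi> k s)\<^sup>2 \<partial>lborel)"
      by (rule wiener_pair_isometry[OF wiener_pair_diff[OF w w] ab(1)])
    also have "\<dots> \<le> (\<integral>s. 2 * (?f s - ?\<phi> j s)\<^sup>2 + 2 * (?f s - ?\<phi> k s)\<^sup>2 \<partial>lborel)"
    proof (rule integral_mono)
      show "(?\<phi> j s - ?\<phi> k s)\<^sup>2 \<le> 2 * (?f s - ?\<phi> j s)\<^sup>2 + 2 * (?f s - ?\<phi> k s)\<^sup>2" for s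
        using zero_le_power2[of "(?f s - ?\<phi> j s) + (?f s - ?\<phi> k s)"]
        by (simp add: power2_eq_square algebra_simps)
    qed (auto intro!: L2_square_integrable L2_diff L f)
    also have "\<dots> = 2 * (\<integral>s. (?f s - ?\<phi> j s)\<^sup>2 \<partial>lborel) + 2 * (\<integral>s. (?f s - ?\<phi> k s)\<^sup>2 \<partial>lborel)"
      by (subst Bochner_Integration.integral_add)
         (auto intro!: L2_square_integrable L2_diff L f)
    also have "\<dots> \<le> 2 * (1/4) ^ j + 2 * (1/4) ^ k"
      using close[of j] close[of k] by simp
    also have "(1/4 :: real) ^ j \<le> (1/4) ^ k" using that by (intro power_decreasing) auto
    finally show ?thesis by simp
  qed
  obtain X where X: "X \<in> borel_measurable ?G" "X \<in> L2 M" "(\<lambda>k. \<integral>\<omega>. (?Z k \<omega> - X \<omega>)\<^sup>2 \<partial>M) \<longlonglongrightarrow> 0"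
    by (rule L2_limit_of_rapidly_Cauchy[OF sub ZG L(2) cauchy])
  have "ennreal ((f s - ?\<phi> k s)\<^sup>2) * indicator {a..b} s = ennreal ((?f s - ?\<phi> k s)\<^sup>2)" for k s
    using step_function_outside[OF part[of k], of s "c k"] by (auto simp: indicator_def)
  moreover have "(\<lambda>k. \<integral>s. (?f s - ?\<phi> k s)\<^sup>2 \<partial>lborel) \<longlonglongrightarrow> 0"
    by (rule tendsto_sandwich[where f = "\<lambda>_. 0" and h = "\<lambda>k. (1/4) ^ k"])
       (use close in \<open>auto intro!: always_eventually less_imp_le LIMSEQ_power_zero\<close>)
  ultimately have lim1: "(\<lambda>k. \<integral>\<^sup>+s\<in>{a..b}. ennreal ((f s - ?\<phi> k s)\<^sup>2) \<partial>lborel) \<longlonglongrightarrow> 0"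
    by (simp add: L2_nn_integral_square[OF L2_diff[OF f L(1)]] ennreal_tendsto_0_iff)
  have "(\<integral>\<^sup>+\<omega>. ennreal ((X \<omega> - ?Z k \<omega>)\<^sup>2) \<partial>M) = ennreal (\<integral>\<omega>. (?Z k \<omega> - X \<omega>)\<^sup>2 \<partial>M)" for k
    unfolding L2_nn_integral_square[OF L2_diff[OF L(2) X(2)], symmetric]
    by (simp only: power2_commute)
  then have lim2: "(\<lambda>k. \<integral>\<^sup>+\<omega>. ennreal ((X \<omega> - ?Z k \<omega>)\<^sup>2) \<partial>M) \<longlonglongrightarrow> 0"
    using X(3) by (simp add: ennreal_tendsto_0_iff)
  have m: "set_borel_measurable lborel {a..b} f"
    using L2_measurable[OF f] by (simp add: set_borel_measurable_def)
  have "has_ito_integral M B a b f X"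
    unfolding has_ito_integral_def
    by (rule conjI[OF m conjI[OF L2_measurable[OF X(2)] conjI[OF L2_square_integrable[OF X(2)]]]],
        rule exI[of _ n], rule exI[of _ p], rule exI[of _ c], intro conjI allI part lim1 lim2)
  with that X(1) show ?thesis by blast
qed

lemma ito_integral_has_ito_integral:
  assumes "0 \<le> a" "a \<le> b" "continuous_on {a..<b} f" "(\<lambda>s. indicator {a..b} s * f s) \<in> L2 lborel"
  shows "has_ito_integral M B a b f (ito_integral M B a b f)"
proof -
  obtain X where "has_ito_integral M B a b f X"
    using ex_ito_integral_past_measurable[OF assms] by blast
  then show ?thesis unfolding ito_integral_def by (rule someI[of "has_ito_integral M B a b f"])
qed

end

section \<open>The Riemann-Liouville kernel\<close>

lemma has_bochner_integral_powr_kernel: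
  fixes a t q :: real
  assumes "a \<le> t" "-1 < q"
  shows "has_bochner_integral lborel (\<lambda>s. indicator {a..t} s * (t - s) powr q)
    ((t - a) powr (q + 1) / (q + 1))"
proof -
  let ?I = "(t - a) powr (q + 1) / (q + 1)"
  let ?g = "\<lambda>x. indicator {0..t - a} x * x powr q"
  have "((\<lambda>x. if x \<in> {0..t - a} then x powr q else 0) has_integral ?I) UNIV"
    unfolding has_integral_restrict_UNIV by (rule has_integral_powr_from_0) (use assms in auto)
  also have "(\<lambda>x. if x \<in> {0..t - a} then x powr q else 0) = ?g" by (auto simp: indicator_def)
  finally have "(\<integral>\<^sup>+x. ennreal (?g x) \<partial>lborel) = ennreal ?I"
    by (intro nn_integral_has_integral_lborel) auto
  then have "has_bochner_integral lborel ?g ?I"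
    using assms(2) by (intro has_bochner_integral_nn_integral) auto
  then have "has_bochner_integral lborel (\<lambda>s. ?g (t + -1 * s)) (?I /\<^sub>R \<bar>-1\<bar>)"
    by (subst (asm) lborel_has_bochner_integral_real_affine_iff[of "-1" _ _ t]) simp_all
  also have "(\<lambda>s. ?g (t + -1 * s)) = (\<lambda>s. indicator {a..t} s * (t - s) powr q)"
    by (auto simp: indicator_def)
  finally show ?thesis by simp
qed

lemma riemann_liouville_kernel_L2:
  fixes a t h :: real
  assumes "a \<le> t" "0 < h"
  shows "(\<lambda>s. indicator {a..t} s * (t - s) powr (h - 1/2)) \<in> L2 lborel"
    and "(\<integral>s. (indicator {a..t} s * (t - s) powr (h - 1/2))\<^sup>2 \<partial>lborel) = (t - a) powr (2 * h) / (2 * h)"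
proof -
  have "(x powr (h - 1/2))\<^sup>2 = x powr (2 * h - 1)" for x :: real
    by (simp add: power2_eq_square flip: powr_add)
  then have eq: "(\<lambda>s. (indicator {a..t} s * (t - s) powr (h - 1/2))\<^sup>2) =
      (\<lambda>s. indicator {a..t} s * (t - s) powr (2 * h - 1))"
    by (auto simp: indicator_def)
  have "has_bochner_integral lborel (\<lambda>s. (indicator {a..t} s * (t - s) powr (h - 1/2))\<^sup>2)
      ((t - a) powr (2 * h) / (2 * h))"
    using has_bochner_integral_powr_kernel[of a t "2 * h - 1"] assms by (simp add: eq)
  then show "(\<lambda>s. indicator {a..t} s * (t - s) powr (h - 1/2)) \<in> L2 lborel"
    "(\<integral>s. (indicator {a..t} s * (t - s) powr (h - 1/2))\<^sup>2 \<partial>lborel) = (t - a) powr (2 * h) / (2 * h)"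
    by (auto intro!: L2_I simp: has_bochner_integral_iff)
qed

lemma continuous_on_riemann_liouville_kernel:
  fixes a t h :: real
  shows "continuous_on {a..<t} (\<lambda>s. (t - s) powr (h - 1/2))"
  by (intro continuous_on_powr continuous_intros) auto

section \<open>Conditional variance given the strict past\<close>

context standard_brownian_motion
begin

lemma ito_integral_wiener_pair:
  assumes "0 \<le> a" "a \<le> b" "continuous_on {a..<b} f" "(\<lambda>s. indicator {a..b} s * f s) \<in> L2 lborel"
  shows "wiener_pair M B a (\<lambda>s. indicator {a..b} s * f s) (ito_integral M B a b f)"
  using ito_wiener_pair[OF ito_integral_has_ito_integral[OF assms] assms(1,4)] .

text \<open>The conditional expectation is the part of the integral before \<open>t0\<close>, since the part after \<open>t0\<close> has
mean zero on each event of the past. What is left is the square of the later part, whose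
conditional expectation is its second moment because the isometry holds on each event of the past.\<close>

lemma cond_variance_ito_integral:
  fixes k :: real
  assumes t0: "0 \<le> t0" "t0 \<le> t" and cont: "continuous_on {0..<t} f"
    and f: "(\<lambda>s. indicator {0..t} s * f s) \<in> L2 lborel"
  shows "AE \<omega> in M. cond_variance M (strict_past M B t0) (\<lambda>\<omega>. k * ito_integral M B 0 t f \<omega>) \<omega> =
    k\<^sup>2 * (\<integral>s. (indicator {t0..t} s * f s)\<^sup>2 \<partial>lborel)"
proof -
  let ?G = "strict_past M B t0"
  have sub: "subalgebra M ?G"
    unfolding strict_past_eq_history by (rule subalgebra_history) auto
  interpret finite_measure_subalgebra M ?G by standard (rule sub)
  have restr: "(\<lambda>s. indicator {a..b} s * f s) \<in> L2 lborel" if "0 \<le> a" "b \<le> t" for a b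
  proof -
    have "(\<lambda>s. indicator {a..b} s * (indicator {0..t} s * f s)) \<in> L2 lborel"
      by (rule L2_indicator_mult[OF f]) simp
    also have "(\<lambda>s. indicator {a..b} s * (indicator {0..t} s * f s)) = (\<lambda>s. indicator {a..b} s * f s)"
      using that by (auto simp: indicator_def)
    finally show ?thesis .
  qed
  define X where "X = ito_integral M B 0 t f"
  define L where "L = ito_integral M B t0 t f"
  obtain A where AG: "A \<in> borel_measurable ?G" and ito: "has_ito_integral M B 0 t0 f A"
    using ex_ito_integral_past_measurable[of 0 t0 f] t0 restr[of 0 t0]
      continuous_on_subset[OF cont, of "{0..<t0}"] by auto
  have wX: "wiener_pair M B 0 (\<lambda>s. indicator {0..t} s * f s) X"
    unfolding X_def using t0 cont f by (intro ito_integral_wiener_pair) auto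
  have wA: "wiener_pair M B 0 (\<lambda>s. indicator {0..t0} s * f s) A"
    using t0 by (intro ito_wiener_pair[OF ito] restr) auto
  have wL: "wiener_pair M B t0 (\<lambda>s. indicator {t0..t} s * f s) L"
    unfolding L_def using t0 restr[of t0 t] continuous_on_subset[OF cont, of "{t0..<t}"]
    by (intro ito_integral_wiener_pair) auto
  have XAL: "AE \<omega> in M. X \<omega> = A \<omega> + L \<omega>"
  proof (rule wiener_pair_unique[OF wX wiener_pair.add[OF wA wiener_pair_mono[OF wL t0(1)]]])
    show "AE s in lborel. indicator {0..t} s * f s =
        indicator {0..t0} s * f s + indicator {t0..t} s * f s"
      using AE_lborel_singleton[of t0] by eventually_elim (use t0 in \<open>auto simp: indicator_def\<close>)
  qed simp
  have XL: "X \<in> L2 M" "A \<in> L2 M" "L \<in> L2 M"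
    using wiener_pair_L2[OF wX] wiener_pair_L2[OF wA] wiener_pair_L2[OF wL] t0 by auto
  note [measurable] = XL[THEN L2_measurable]
  have int: "integrable M Z" if "Z \<in> L2 M" for Z
    using L2_mult_integrable[OF that L2_const[of 1]] by simp
  have FH: "F \<in> sets (history M B {0..t0})" "F \<in> sets M" if "F \<in> sets ?G" for F
  proof -
    show "F \<in> sets (history M B {0..t0})"
      using that sets_history_mono[of "{0..<t0}" "{0..t0}" M B]
      by (auto simp: strict_past_eq_history subset_eq)
    show "F \<in> sets M" using that sub by (auto simp: subalgebra_def)
  qed
  have mean: "AE \<omega> in M. real_cond_exp M ?G (\<lambda>\<omega>. k * X \<omega>) \<omega> = k * A \<omega>"
  proof (rule real_cond_exp_charact)
    fix F assume F: "F \<in> sets ?G"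
    note [measurable] = FH(2)[OF F]
    have ind: "integrable M (\<lambda>\<omega>. indicator F \<omega> * Z \<omega>)" if "Z \<in> L2 M" for Z
      by (rule int[OF L2_indicator_mult[OF that FH(2)[OF F]]])
    have "(\<integral>\<omega>. indicator F \<omega> * X \<omega> \<partial>M) = (\<integral>\<omega>. indicator F \<omega> * A \<omega> + indicator F \<omega> * L \<omega> \<partial>M)"
    proof (rule integral_cong_AE)
      show "AE \<omega> in M. indicator F \<omega> * X \<omega> = indicator F \<omega> * A \<omega> + indicator F \<omega> * L \<omega>"
        using XAL by eventually_elim (simp add: distrib_left)
    qed measurable
    also have "\<dots> = (\<integral>\<omega>. indicator F \<omega> * A \<omega> \<partial>M)"
      using wiener_pair_mean_past[OF FH(1)[OF F] t0(1) wL] ind XL by simp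
    finally show "(\<integral>\<omega>\<in>F. k * X \<omega> \<partial>M) = (\<integral>\<omega>\<in>F. k * A \<omega> \<partial>M)"
      by (simp add: set_lebesgue_integral_def mult.left_commute[of _ k])
  qed (use AG XL int in auto)
  define V where "V \<omega> = (k * X \<omega> - real_cond_exp M ?G (\<lambda>\<omega>. k * X \<omega>) \<omega>)\<^sup>2" for \<omega>
  define v where "v = k\<^sup>2 * (\<integral>s. (indicator {t0..t} s * f s)\<^sup>2 \<partial>lborel)"
  have VM [measurable]: "V \<in> borel_measurable M"
    unfolding V_def using borel_measurable_cond_exp2 by measurable
  have VL: "AE \<omega> in M. V \<omega> = k\<^sup>2 * (L \<omega>)\<^sup>2"
    using mean XAL by eventually_elim (simp add: V_def algebra_simps power2_eq_square)
  have "AE \<omega> in M. real_cond_exp M ?G V \<omega> = v"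
  proof (rule real_cond_exp_charact)
    fix F assume F: "F \<in> sets ?G"
    note [measurable] = FH(2)[OF F]
    have "(\<integral>\<omega>. indicator F \<omega> * V \<omega> \<partial>M) = (\<integral>\<omega>. k\<^sup>2 * (indicator F \<omega> * L \<omega> * L \<omega>) \<partial>M)"
    proof (rule integral_cong_AE)
      show "AE \<omega> in M. indicator F \<omega> * V \<omega> = k\<^sup>2 * (indicator F \<omega> * L \<omega> * L \<omega>)"
        using VL by eventually_elim (simp add: power2_eq_square)
    qed measurable
    also have "\<dots> = prob F * v"
      using wiener_pair_isometry_past[OF FH(1)[OF F] t0(1) wL wL]
      by (simp add: v_def power2_eq_square)
    finally show "(\<integral>\<omega>\<in>F. V \<omega> \<partial>M) = (\<integral>\<omega>\<in>F. v \<partial>M)"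
      using FH(2)[OF F] by (simp add: set_lebesgue_integral_def)
  next
    have "integrable M (\<lambda>\<omega>. k\<^sup>2 * (L \<omega>)\<^sup>2)"
      using L2_square_integrable[OF XL(3)] by simp
    then show "integrable M V"
      using integrable_cong_AE[OF VM _ VL] by simp
  qed simp_all
  then show ?thesis
    unfolding cond_variance_def V_def v_def X_def .
qed

text \<open>The factor \<open>sqrt (2 H)\<close> is exactly what normalises the squared \<open>L\<^sup>2\<close> norm of the kernel.\<close>

lemma local_part_second_moment:
  assumes "0 \<le> t0" "0 < \<epsilon>" "0 < H (t0 + \<epsilon>)"
  shows "(\<integral>\<omega>. (local_part M B H t0 \<epsilon> \<omega>)\<^sup>2 \<partial>M) = \<epsilon> powr (2 * H (t0 + \<epsilon>))"
proof -
  let ?h = "H (t0 + \<epsilon>)" and ?f = "\<lambda>s. (t0 + \<epsilon> - s) powr (H (t0 + \<epsilon>) - 1/2)"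
  have w: "wiener_pair M B t0 (\<lambda>s. indicator {t0..t0+\<epsilon>} s * ?f s) (ito_integral M B t0 (t0 + \<epsilon>) ?f)"
    using assms
    by (intro ito_integral_wiener_pair continuous_on_riemann_liouville_kernel riemann_liouville_kernel_L2)
       auto
  have "(\<integral>\<omega>. (local_part M B H t0 \<epsilon> \<omega>)\<^sup>2 \<partial>M) =
      2 * ?h * (\<integral>\<omega>. (ito_integral M B t0 (t0 + \<epsilon>) ?f \<omega>)\<^sup>2 \<partial>M)"
    using assms(3) by (simp add: local_part_def power_mult_distrib)
  also have "(\<integral>\<omega>. (ito_integral M B t0 (t0 + \<epsilon>) ?f \<omega>)\<^sup>2 \<partial>M) =
      (t0 + \<epsilon> - t0) powr (2 * ?h) / (2 * ?h)"
    unfolding wiener_pair_isometry[OF w assms(1)]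
    using assms by (intro riemann_liouville_kernel_L2) auto
  finally show ?thesis using assms(3) by simp
qed

lemma cond_variance_tv_fbm:
  assumes "0 \<le> t0" "0 < \<epsilon>" "0 < H (t0 + \<epsilon>)"
  shows "AE \<omega> in M. cond_variance M (strict_past M B t0) (tv_fbm M B H (t0 + \<epsilon>)) \<omega> =
    \<epsilon> powr (2 * H (t0 + \<epsilon>))"
proof -
  let ?h = "H (t0 + \<epsilon>)" and ?f = "\<lambda>s. (t0 + \<epsilon> - s) powr (H (t0 + \<epsilon>) - 1/2)"
  have "AE \<omega> in M. cond_variance M (strict_past M B t0)
      (\<lambda>\<omega>. sqrt (2 * ?h) * ito_integral M B 0 (t0 + \<epsilon>) ?f \<omega>) \<omega> =
    (sqrt (2 * ?h))\<^sup>2 * (\<integral>s. (indicator {t0..t0 + \<epsilon>} s * ?f s)\<^sup>2 \<partial>lborel)"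
    using assms
    by (intro cond_variance_ito_integral continuous_on_riemann_liouville_kernel riemann_liouville_kernel_L2)
       auto
  moreover have "(sqrt (2 * ?h))\<^sup>2 * (\<integral>s. (indicator {t0..t0 + \<epsilon>} s * ?f s)\<^sup>2 \<partial>lborel) = \<epsilon> powr (2 * ?h)"
    using assms by (simp add: riemann_liouville_kernel_L2)
  ultimately show ?thesis unfolding tv_fbm_def by simp
qed

lemma one_plus_remainder:
  assumes "0 \<le> t0" "0 < \<epsilon>" "0 < H (t0 + \<epsilon>)"
  shows "1 + remainder M B H t0 \<epsilon> = \<epsilon> powr (2 * (H (t0 + \<epsilon>) - H t0))"
proof -
  let ?p = "\<epsilon> powr (2 * (H (t0 + \<epsilon>) - H t0))"
  have split: "\<epsilon> powr (2 * H (t0 + \<epsilon>)) = \<epsilon> powr (2 * H t0) * ?p"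
    by (simp flip: powr_add)
  have pos: "\<epsilon> powr (2 * H t0) \<noteq> 0" using assms(2) by simp
  have "remainder M B H t0 \<epsilon> = ?p - 1"
    unfolding remainder_def local_part_second_moment[where H = H, OF assms] split
    by (rule the_equality) (use pos in auto)
  then show ?thesis by simp
qed

end

section \<open>Size of the remainder\<close>

lemma abs_exp_minus_one_le: "\<bar>exp x - 1\<bar> \<le> \<bar>x\<bar> * exp \<bar>x\<bar>" for x :: real
proof (cases "0 \<le> x")
  case True
  have "(1 - x) * exp x \<le> exp (- x) * exp x"
    using exp_ge_add_one_self[of "- x"] by (intro mult_right_mono) auto
  with True show ?thesis by (simp add: algebra_simps flip: exp_add)
next
  case False
  have "\<bar>exp x - 1\<bar> = 1 - exp x" "\<bar>x\<bar> = - x" using False by auto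
  moreover have "1 + x \<le> exp x" by (rule exp_ge_add_one_self)
  moreover have "\<bar>x\<bar> * 1 \<le> \<bar>x\<bar> * exp \<bar>x\<bar>" by (intro mult_left_mono) auto
  ultimately show ?thesis by linarith
qed

text \<open>A logarithm is dominated by any positive power: here \<open>\<bar>ln \<epsilon>\<bar> \<le> \<epsilon>\<^bsup>- h\<^esup> / h\<close>, so the exponent drops
from \<open>\<gamma>\<close> to \<open>\<gamma> - h\<close>.\<close>

lemma hoelder_exponent_change_bound:
  fixes \<epsilon> x C \<gamma> h :: real
  assumes "0 < \<epsilon>" "\<epsilon> \<le> 1" "0 < h" "0 \<le> C" and x: "\<bar>x\<bar> \<le> C * \<epsilon> powr \<gamma>"
  shows "\<bar>2 * x * ln \<epsilon>\<bar> \<le> 2 * C / h * \<epsilon> powr (\<gamma> - h)"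
proof -
  have "\<bar>ln \<epsilon>\<bar> = ln (1 / \<epsilon>)" using assms by (simp add: ln_div)
  also have "\<dots> \<le> (1 / \<epsilon>) powr h / h" using assms by (intro ln_powr_bound) auto
  also have "\<dots> = \<epsilon> powr (- h) / h" using assms by (simp add: powr_divide powr_minus_divide)
  finally have "\<bar>x\<bar> * \<bar>ln \<epsilon>\<bar> \<le> (C * \<epsilon> powr \<gamma>) * (\<epsilon> powr (- h) / h)"
    using x by (intro mult_mono) (use assms in auto)
  also have "\<dots> = C / h * \<epsilon> powr (\<gamma> - h)" by (simp add: powr_diff powr_minus_divide)
  finally show ?thesis by (simp add: abs_mult)
qed

theorem theorem3p4:
  fixes M :: "'a measure" and B :: "real \<Rightarrow> 'a \<Rightarrow> real"
    and H :: "real \<Rightarrow> real" and T \<gamma> C\<^sub>H H\<^sub>i\<^sub>n\<^sub>f t\<^sub>0 lam :: real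
  assumes "T > 0"
    and "\<And>t. t \<in> {0..T} \<Longrightarrow> H t \<in> {0<..<1}"
    and "hoelder_continuous_on {0..T} \<gamma> C\<^sub>H H"
    and "\<gamma> > (SUP t\<in>{0..T}. H t)"
    and "H\<^sub>i\<^sub>n\<^sub>f > 0" and "(INF t\<in>{0..T}. H t) \<ge> H\<^sub>i\<^sub>n\<^sub>f"
    and "standard_brownian_motion M B"
    and "t\<^sub>0 \<in> {0..<T}"
    and "lam = min (\<gamma> - H t\<^sub>0) ((\<gamma> + H t\<^sub>0) / 2)"
  shows "\<exists>\<epsilon>\<^sub>0>0. t\<^sub>0 + \<epsilon>\<^sub>0 \<le> T \<and>
    (\<exists>c>0.
       variance_lower_bound M B H t\<^sub>0 \<epsilon>\<^sub>0 c \<and>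
       (\<forall>c'. variance_lower_bound M B H t\<^sub>0 \<epsilon>\<^sub>0 c' \<longrightarrow> c' \<le> c) \<and>
       c = (INF \<epsilon>\<in>{0<..\<epsilon>\<^sub>0}. 1 + remainder M B H t\<^sub>0 \<epsilon>)) \<and>
    (\<exists>c\<^sub>1>0. \<forall>\<epsilon>\<in>{0<..\<epsilon>\<^sub>0}. \<bar>remainder M B H t\<^sub>0 \<epsilon>\<bar> \<le> c\<^sub>1 * \<epsilon> powr lam) \<and>
    ((\<lambda>\<epsilon>. 1 + remainder M B H t\<^sub>0 \<epsilon>) \<longlongrightarrow> 1) (at_right 0)"
proof -
  interpret standard_brownian_motion M B by fact
  let ?r = "remainder M B H t\<^sub>0"
  \<comment> \<open>Bounding \<open>e0\<close> by \<open>1\<close> makes powers of \<open>\<epsilon>\<close> decrease in the exponent, so that \<open>lam\<close> may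
    replace \<open>\<gamma> - H t\<^sub>0\<close> in upper bounds.\<close>
  define e0 where "e0 = min 1 (T - t\<^sub>0)"
  define K where "K = 2 * C\<^sub>H / H t\<^sub>0"
  have t0: "0 \<le> t\<^sub>0" "t\<^sub>0 \<in> {0..T}" and h0: "0 < H t\<^sub>0" and C: "0 < C\<^sub>H"
    using assms(2)[of t\<^sub>0] assms(3,8) by (auto simp: hoelder_continuous_on_def)
  have e0: "0 < e0" "t\<^sub>0 + e0 \<le> T" "e0 \<le> 1" using assms(8) by (auto simp: e0_def)
  have K: "0 < K" using C h0 by (simp add: K_def)
  have "bdd_above (H ` {0..T})"
    using assms(2) by (intro bdd_aboveI2[of _ _ 1]) (simp add: less_imp_le)
  then have "H t\<^sub>0 < \<gamma>"
    using cSUP_upper[OF t0(2)] assms(4) by (meson le_less_trans)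
  then have lam: "0 < lam" "lam \<le> \<gamma> - H t\<^sub>0" using h0 assms(9) by auto
  have range: "t\<^sub>0 + \<epsilon> \<in> {0..T}" "0 < \<epsilon>" "\<epsilon> \<le> 1" if "\<epsilon> \<in> {0<..e0}" for \<epsilon>
    using that e0 t0 by auto
  have Hpos: "0 < H (t\<^sub>0 + \<epsilon>)" if "\<epsilon> \<in> {0<..e0}" for \<epsilon>
    using assms(2)[OF range(1)[OF that]] by simp
  \<comment> \<open>The logarithm of \<open>1 + r(\<epsilon>)\<close>.\<close>
  define x where "x \<epsilon> = 2 * (H (t\<^sub>0 + \<epsilon>) - H t\<^sub>0) * ln \<epsilon>" for \<epsilon>
  have r: "1 + ?r \<epsilon> = exp (x \<epsilon>)" if "\<epsilon> \<in> {0<..e0}" for \<epsilon>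
    using one_plus_remainder[where H = H, OF t0(1) range(2)[OF that] Hpos[OF that]] that
    by (simp add: powr_def x_def)
  have xb: "\<bar>x \<epsilon>\<bar> \<le> K * \<epsilon> powr (\<gamma> - H t\<^sub>0)" if "\<epsilon> \<in> {0<..e0}" for \<epsilon>
    unfolding x_def K_def
  proof (rule hoelder_exponent_change_bound)
    have "\<bar>H (t\<^sub>0 + \<epsilon>) - H t\<^sub>0\<bar> \<le> C\<^sub>H * \<bar>t\<^sub>0 + \<epsilon> - t\<^sub>0\<bar> powr \<gamma>"
      using assms(3) range(1)[OF that] t0(2) unfolding hoelder_continuous_on_def by blast
    then show "\<bar>H (t\<^sub>0 + \<epsilon>) - H t\<^sub>0\<bar> \<le> C\<^sub>H * \<epsilon> powr \<gamma>" using that by simp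
  qed (use range[OF that] h0 C in auto)
  have xK: "\<bar>x \<epsilon>\<bar> \<le> K" and xlam: "\<bar>x \<epsilon>\<bar> \<le> K * \<epsilon> powr lam" if "\<epsilon> \<in> {0<..e0}" for \<epsilon>
  proof -
    have "\<epsilon> powr (\<gamma> - H t\<^sub>0) \<le> \<epsilon> powr lam"
      using range[OF that] lam by (intro powr_mono') auto
    then have "K * \<epsilon> powr (\<gamma> - H t\<^sub>0) \<le> K * \<epsilon> powr lam"
      using K by (intro mult_left_mono) auto
    with xb[OF that] show xlam: "\<bar>x \<epsilon>\<bar> \<le> K * \<epsilon> powr lam" by linarith
    have "\<epsilon> powr lam \<le> 1" using range[OF that] lam by (intro powr_le1) auto
    then have "K * \<epsilon> powr lam \<le> K * 1" using K by (intro mult_left_mono) auto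
    with xlam show "\<bar>x \<epsilon>\<bar> \<le> K" by linarith
  qed
  have rbound: "\<bar>?r \<epsilon>\<bar> \<le> K * exp K * \<epsilon> powr lam" if "\<epsilon> \<in> {0<..e0}" for \<epsilon>
  proof -
    have "\<bar>?r \<epsilon>\<bar> = \<bar>exp (x \<epsilon>) - 1\<bar>" using r[OF that] by simp
    also have "\<dots> \<le> \<bar>x \<epsilon>\<bar> * exp \<bar>x \<epsilon>\<bar>" by (rule abs_exp_minus_one_le)
    also have "\<dots> \<le> (K * \<epsilon> powr lam) * exp K"
      using xK[OF that] xlam[OF that] K by (intro mult_mono) auto
    finally show ?thesis by (simp add: mult_ac)
  qed
  have var: "AE \<omega> in M. cond_variance M (strict_past M B t\<^sub>0) (tv_fbm M B H (t\<^sub>0 + \<epsilon>)) \<omega> =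
      (1 + ?r \<epsilon>) * \<epsilon> powr (2 * H t\<^sub>0)" if "\<epsilon> \<in> {0<..e0}" for \<epsilon>
  proof -
    have "(1 + ?r \<epsilon>) * \<epsilon> powr (2 * H t\<^sub>0) = \<epsilon> powr (2 * H (t\<^sub>0 + \<epsilon>))"
      unfolding one_plus_remainder[where H = H, OF t0(1) range(2)[OF that] Hpos[OF that]]
      by (simp flip: powr_add)
    then show ?thesis
      using cond_variance_tv_fbm[where H = H, OF t0(1) range(2)[OF that] Hpos[OF that]] by simp
  qed
  define c where "c = (INF \<epsilon>\<in>{0<..e0}. 1 + ?r \<epsilon>)"
  have lower: "exp (- K) \<le> 1 + ?r \<epsilon>" if "\<epsilon> \<in> {0<..e0}" for \<epsilon>
    using xK[OF that] r[OF that] by simp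
  then have bdd: "bdd_below ((\<lambda>\<epsilon>. 1 + ?r \<epsilon>) ` {0<..e0})" by (rule bdd_belowI2)
  have ne: "{0<..e0} \<noteq> {}" using e0 by simp
  have c_le: "c \<le> 1 + ?r \<epsilon>" if "\<epsilon> \<in> {0<..e0}" for \<epsilon>
    unfolding c_def by (rule cINF_lower[OF bdd that])
  have "exp (- K) \<le> c" unfolding c_def by (rule cINF_greatest[OF ne lower])
  then have c_pos: "0 < c" using exp_gt_zero[of "- K"] by linarith
  have bound: "variance_lower_bound M B H t\<^sub>0 e0 c"
    unfolding variance_lower_bound_def
  proof
    fix \<epsilon> assume e: "\<epsilon> \<in> {0<..e0}"
    have le: "c * \<epsilon> powr (2 * H t\<^sub>0) \<le> (1 + ?r \<epsilon>) * \<epsilon> powr (2 * H t\<^sub>0)"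
      by (intro mult_right_mono c_le[OF e]) simp
    show "AE \<omega> in M. c * \<epsilon> powr (2 * H t\<^sub>0) \<le>
        cond_variance M (strict_past M B t\<^sub>0) (tv_fbm M B H (t\<^sub>0 + \<epsilon>)) \<omega>"
      using var[OF e] by eventually_elim (use le in simp)
  qed
  have optimal: "c' \<le> c" if "variance_lower_bound M B H t\<^sub>0 e0 c'" for c'
    unfolding c_def
  proof (rule cINF_greatest[OF ne])
    fix \<epsilon> assume e: "\<epsilon> \<in> {0<..e0}"
    have "AE \<omega> in M. c' * \<epsilon> powr (2 * H t\<^sub>0) \<le>
        cond_variance M (strict_past M B t\<^sub>0) (tv_fbm M B H (t\<^sub>0 + \<epsilon>)) \<omega>"
      using that e unfolding variance_lower_bound_def by blast
    then have "AE \<omega> in M. c' * \<epsilon> powr (2 * H t\<^sub>0) \<le> (1 + ?r \<epsilon>) * \<epsilon> powr (2 * H t\<^sub>0)"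
      using var[OF e] by eventually_elim simp
    then have "c' * \<epsilon> powr (2 * H t\<^sub>0) \<le> (1 + ?r \<epsilon>) * \<epsilon> powr (2 * H t\<^sub>0)" by simp
    then show "c' \<le> 1 + ?r \<epsilon>" using e by simp
  qed
  have lim: "((\<lambda>\<epsilon>. 1 + ?r \<epsilon>) \<longlongrightarrow> 1) (at_right 0)"
  proof -
    have "((\<lambda>\<epsilon>. K * exp K * \<epsilon> powr lam) \<longlongrightarrow> K * exp K * 0 powr lam) (at_right 0)"
      using lam by (intro tendsto_mult tendsto_const tendsto_powr2 tendsto_ident_at)
         (auto simp: eventually_at_filter)
    then have "((\<lambda>\<epsilon>. K * exp K * \<epsilon> powr lam) \<longlongrightarrow> 0) (at_right 0)" by simp
    moreover have "\<forall>\<^sub>F \<epsilon> in at_right 0. norm (?r \<epsilon>) \<le> K * exp K * \<epsilon> powr lam"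
      using eventually_at_right_less[of 0] eventually_at_rightI[of 0 e0 "\<lambda>\<epsilon>. \<epsilon> \<in> {0<..e0}"] e0
      by (auto elim!: eventually_mono simp: rbound)
    ultimately have "(?r \<longlongrightarrow> 0) (at_right 0)" by (rule Lim_null_comparison[rotated])
    then show ?thesis using tendsto_add[OF tendsto_const[of 1]] by fastforce
  qed
  show ?thesis
  proof (rule exI[of _ e0], intro conjI)
    show "\<exists>c>0. variance_lower_bound M B H t\<^sub>0 e0 c \<and>
       (\<forall>c'. variance_lower_bound M B H t\<^sub>0 e0 c' \<longrightarrow> c' \<le> c) \<and>
       c = (INF \<epsilon>\<in>{0<..e0}. 1 + ?r \<epsilon>)"
      using c_pos bound optimal c_def by blast
    show "\<exists>c\<^sub>1>0. \<forall>\<epsilon>\<in>{0<..e0}. \<bar>?r \<epsilon>\<bar> \<le> c\<^sub>1 * \<epsilon> powr lam"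
      using K rbound by (intro exI[of _ "K * exp K"]) auto
  qed (use e0 lim in auto)
qed

end
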